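(* Let $L=\widehat{b}$ be an oriented link obtained as the closure of a positive braid $b\in B_n$ of $n$ strands and writhe $w$. Then $b$ admits a simple resolution tree. Moreover, given a simple resolution tree of $b$, one has $\partial_v^+(P(L))=w+n-1$ if and only if at least one leaf of this simple resolution tree is the identity braid.
   Context: $B_n$ is the braid group on $n$ strands with standard generators $\sigma_1,\dots,\sigma_{n-1}$, where $\sigma_i$ is a positive crossing; $\widehat{b}$ denotes the oriented link obtained as the closure of $b\in B_n$. A braid is positive if it can be written as a (possibly empty) product of the $\sigma_i$ with no inverses; the writhe of a braid is the exponent sum of any word in the $\sigma_i^{\pm1}$ representing it. The Homflypt polynomial $P(L)=P_L(v,z)\in\mathbb{Z}[v^{\pm1},z^{\pm1}]$ is the isotopy invariant of oriented links determined by $P(\text{unknot})=1$ and the skein relation $v^{-1}P(L_+)-vP(L_-)=zP(L_0)$, where $L_+,L_-,L_0$ differ only near one crossing, which is respectively positive, negative, and smoothed according to orientation. $\partial_v^+(P(L))$ denotes the highest $v$-degree of $P(L)$. The number $w+n-1$ is called the Morton-Franks-Williams (MFW) upper bound of $b$. A simple braid in $B_n$ is a positive braid $T_\alpha$, $\alpha\in S_n$, where $T_\alpha$ is the unique positive braid inducing the permutation $\alpha$ on its endpoints and such that every two strands cross at most once. A resolution tree of a positive braid $b\in B_n$ is a finite rooted binary tree whose nodes are labelled by positive braids in $B_n$, with root labelled by $b$, such that each non-leaf node, labelled by $\beta$, comes with a decomposition $\beta=P\sigma_i^2Q$ in $B_n$, with $P,Q\in B_n$ positive braids and $1\le i\le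 n-1$, and has exactly two children: the left child labelled by $PQ$ and the right child labelled by $P\sigma_iQ$. (This corresponds to the quadratic skein relation $\sigma_i^2=vz\sigma_i+v^2$, the left edge carrying the coefficient $v^2$ and the right edge the coefficient $vz$.) A resolution tree is simple if all its leaves are simple braids. *)

theory Defs
  imports
    "HOL-Algebra.Group"
    "HOL-Combinatorics.Permutations"
    "HOL-Library.Poly_Mapping"
    "HOL-Library.Product_Plus"
begin

section \<open>Braid groups\<close>

text \<open>
  The letter \<open>(i, True)\<close> is the generator \<open>\<sigma>\<^sub>i\<close> and \<open>(i, False)\<close> its inverse. Generators and strand
  positions are numbered from 1. The group \<open>B\<^sub>n\<close> is given by Artin's presentation; its elements are
  classes of words.
\<close>

type_synonym braid_word = "(nat \<times> bool) list"
type_synonym braid = "braid_word set"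

definition braid_words :: "nat \<Rightarrow> braid_word set" where
  "braid_words n = lists ({1..<n} \<times> UNIV)"

inductive braid_relation :: "nat \<Rightarrow> braid_word \<Rightarrow> braid_word \<Rightarrow> bool" for n where
  cancel: "i \<in> {1..<n} \<Longrightarrow> braid_relation n [(i, e), (i, \<not> e)] []"
| commute: "i \<in> {1..<n} \<Longrightarrow> j \<in> {1..<n} \<Longrightarrow> i + 2 \<le> j \<Longrightarrow>
    braid_relation n [(i, True), (j, True)] [(j, True), (i, True)]"
| braid: "i \<in> {1..<n} \<Longrightarrow> Suc i \<in> {1..<n} \<Longrightarrow>
    braid_relation n [(i, True), (Suc i, True), (i, True)] [(Suc i, True), (i, True), (Suc i, True)]"

inductive braid_equiv :: "nat \<Rightarrow> braid_word \<Rightarrow> braid_word \<Rightarrow> bool" for n where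
  refl: "w \<in> braid_words n \<Longrightarrow> braid_equiv n w w"
| step: "braid_relation n x y \<Longrightarrow> u \<in> braid_words n \<Longrightarrow> v \<in> braid_words n \<Longrightarrow>
    braid_equiv n (u @ x @ v) (u @ y @ v)"
| sym: "braid_equiv n x y \<Longrightarrow> braid_equiv n y x"
| trans: "braid_equiv n x y \<Longrightarrow> braid_equiv n y z \<Longrightarrow> braid_equiv n x z"

definition braid_class :: "nat \<Rightarrow> braid_word \<Rightarrow> braid" where
  "braid_class n w = {(x, y). braid_equiv n x y} `` {w}"

definition braid_group :: "nat \<Rightarrow> braid monoid" where
  "braid_group n =
    \<lparr>carrier = braid_words n // {(x, y). braid_equiv n x y},
     monoid.mult = (\<lambda>A B. \<Union>x\<in>A. \<Union>y\<in>B. braid_class n (x @ y)),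
     one = braid_class n []\<rparr>"

definition braid_gen :: "nat \<Rightarrow> nat \<Rightarrow> braid" where
  "braid_gen n i = braid_class n [(i, True)]"

definition positive_word :: "braid_word \<Rightarrow> bool" where
  "positive_word w \<longleftrightarrow> (\<forall>(i, e) \<in> set w. e)"

definition positive_braids :: "nat \<Rightarrow> braid set" where
  "positive_braids n = {b \<in> carrier (braid_group n). \<exists>w\<in>b. positive_word w}"

definition exponent_sum :: "braid_word \<Rightarrow> int" where
  "exponent_sum w = (\<Sum>(i, e)\<leftarrow>w. if e then 1 else -1)"

definition writhe :: "braid \<Rightarrow> int" where
  "writhe b = exponent_sum (SOME w. w \<in> b)"

lemma braid_words_simps [simp]:
  "[] \<in> braid_words n"
  "(x # w) \<in> braid_words n \<longleftrightarrow> fst x \<in> {1..<n} \<and> w \<in> braid_words n"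
  "(u @ v) \<in> braid_words n \<longleftrightarrow> u \<in> braid_words n \<and> v \<in> braid_words n"
  by (cases x; auto simp: braid_words_def)+

lemma braid_relation_words:
  "braid_relation n x y \<Longrightarrow> x \<in> braid_words n \<and> y \<in> braid_words n"
  by (induction rule: braid_relation.induct) auto

lemma braid_equiv_words:
  "braid_equiv n x y \<Longrightarrow> x \<in> braid_words n \<and> y \<in> braid_words n"
  by (induction rule: braid_equiv.induct) (auto dest: braid_relation_words)

lemma equiv_braid: "equiv (braid_words n) {(x, y). braid_equiv n x y}"
  by (rule equivI)
    (auto intro!: refl_onI symI transI intro: braid_equiv.intros dest: braid_equiv_words)

lemma braid_equiv_context:
  "braid_equiv n x y \<Longrightarrow> u \<in> braid_words n \<Longrightarrow> v \<in> braid_words n \<Longrightarrow>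
    braid_equiv n (u @ x @ v) (u @ y @ v)"
proof (induction rule: braid_equiv.induct)
  case (step x y u' v')
  then show ?case
    using braid_equiv.step[of n x y "u @ u'" "v' @ v"] by simp
qed (auto intro: braid_equiv.intros)

lemma braid_equiv_append:
  assumes "braid_equiv n x x'" "braid_equiv n y y'"
  shows "braid_equiv n (x @ y) (x' @ y')"
proof -
  have "braid_equiv n (x @ y) (x' @ y)"
    using braid_equiv_context[OF assms(1), of "[]" y] braid_equiv_words assms by simp
  moreover have "braid_equiv n (x' @ y) (x' @ y')"
    using braid_equiv_context[OF assms(2), of "x'" "[]"] braid_equiv_words assms by simp
  ultimately show ?thesis by (rule braid_equiv.trans)
qed

lemma in_braid_class: "x \<in> braid_class n w \<longleftrightarrow> braid_equiv n w x"
  by (simp add: braid_class_def)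

lemma braid_class_eq_iff:
  "x \<in> braid_words n \<Longrightarrow> y \<in> braid_words n \<Longrightarrow>
    braid_class n x = braid_class n y \<longleftrightarrow> braid_equiv n x y"
  unfolding braid_class_def using eq_equiv_class_iff[OF equiv_braid, of x n y] by simp

lemma carrier_braid_group: "carrier (braid_group n) = braid_class n ` braid_words n"
  by (auto simp: braid_group_def braid_class_def quotient_def)

lemma one_braid_group: "\<one>\<^bsub>braid_group n\<^esub> = braid_class n []"
  by (simp add: braid_group_def)

lemma mult_braid_class:
  assumes "x \<in> braid_words n" "y \<in> braid_words n"
  shows "braid_class n x \<otimes>\<^bsub>braid_group n\<^esub> braid_class n y = braid_class n (x @ y)"
proof -
  have eq: "braid_class n (x' @ y') = braid_class n (x @ y)"
    if "x' \<in> braid_class n x" "y' \<in> braid_class n y" for x' y'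
  proof -
    have "braid_equiv n (x @ y) (x' @ y')"
      using that by (simp add: in_braid_class braid_equiv_append)
    with braid_equiv_words[OF this] show ?thesis
      by (simp only: braid_class_eq_iff braid_equiv.sym)
  qed
  have mem: "x \<in> braid_class n x" "y \<in> braid_class n y"
    using assms by (simp_all add: in_braid_class braid_equiv.refl)
  have "(\<Union>x'\<in>braid_class n x. \<Union>y'\<in>braid_class n y. braid_class n (x' @ y'))
      = (\<Union>x'\<in>braid_class n x. \<Union>y'\<in>braid_class n y. braid_class n (x @ y))"
    by (intro SUP_cong HOL.refl eq)
  also have "\<dots> = braid_class n (x @ y)"
    using mem by blast
  finally show ?thesis
    by (simp add: braid_group_def)
qed

lemma inverse_word_in_braid_words:
  "w \<in> braid_words n \<Longrightarrow> map (apsnd Not) (rev w) \<in> braid_words n"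
  by (induction w) auto

lemma braid_word_inverse:
  "w \<in> braid_words n \<Longrightarrow> braid_equiv n (map (apsnd Not) (rev w) @ w) []"
proof (induction w)
  case Nil
  then show ?case by (auto intro: braid_equiv.refl)
next
  case (Cons a w)
  obtain i e where a: "a = (i, e)" by (cases a)
  have words: "map (apsnd Not) (rev w) \<in> braid_words n" "w \<in> braid_words n"
    using Cons.prems inverse_word_in_braid_words[of w n] by simp_all
  have "braid_relation n [(i, \<not> e), (i, e)] []"
    using braid_relation.cancel[of i n "\<not> e"] Cons.prems a by simp
  from braid_equiv.step[OF this words]
  have "braid_equiv n (map (apsnd Not) (rev (a # w)) @ a # w) (map (apsnd Not) (rev w) @ w)"
    by (simp add: a)
  with Cons show ?case
    by (auto intro: braid_equiv.trans)
qed

lemma group_braid_group: "group (braid_group n)"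
proof (rule groupI)
  fix x assume "x \<in> carrier (braid_group n)"
  then obtain w where w: "x = braid_class n w" "w \<in> braid_words n"
    by (auto simp: carrier_braid_group)
  have "map (apsnd Not) (rev w) \<in> braid_words n"
    using w inverse_word_in_braid_words by blast
  then show "\<exists>y\<in>carrier (braid_group n). y \<otimes>\<^bsub>braid_group n\<^esub> x = \<one>\<^bsub>braid_group n\<^esub>"
    using w braid_word_inverse[of w n]
    by (intro bexI[of _ "braid_class n (map (apsnd Not) (rev w))"])
      (auto simp: carrier_braid_group one_braid_group mult_braid_class braid_class_eq_iff)
qed (auto simp: carrier_braid_group one_braid_group mult_braid_class)

lemma exponent_sum_equiv: "braid_equiv n x y \<Longrightarrow> exponent_sum x = exponent_sum y"
  by (induction rule: braid_equiv.induct)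
    (auto simp: exponent_sum_def elim!: braid_relation.cases)

lemma writhe_braid_class:
  assumes "w \<in> braid_words n"
  shows "writhe (braid_class n w) = exponent_sum w"
proof -
  have "w \<in> braid_class n w"
    using assms by (simp add: in_braid_class braid_equiv.refl)
  then have "(SOME x. x \<in> braid_class n w) \<in> braid_class n w"
    by (rule someI)
  then show ?thesis
    unfolding writhe_def by (auto simp: in_braid_class dest: exponent_sum_equiv)
qed


section \<open>Simple braids\<close>

text \<open>\<open>strand_pos w k\<close> is the final position of the strand of \<open>w\<close> that starts at position \<open>k\<close>.\<close>

fun strand_pos :: "braid_word \<Rightarrow> nat \<Rightarrow> nat" where
  "strand_pos [] = id"
| "strand_pos ((i, e) # w) = strand_pos w \<circ> transpose i (Suc i)"

definition crossing_number :: "braid_word \<Rightarrow> nat \<Rightarrow> nat \<Rightarrow> nat" where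
  "crossing_number w s t =
    card {m. m < length w \<and>
      {strand_pos (take m w) s, strand_pos (take m w) t} = {fst (w ! m), Suc (fst (w ! m))}}"

text \<open>
  The braid with the following property is unique. The number of crossings of two given strands is
  the same in all positive words for a braid.
\<close>

definition permutation_braid :: "nat \<Rightarrow> (nat \<Rightarrow> nat) \<Rightarrow> braid \<Rightarrow> bool" where
  "permutation_braid n \<alpha> b \<longleftrightarrow> b \<in> carrier (braid_group n) \<and>
    (\<exists>w\<in>b. positive_word w \<and> strand_pos w = \<alpha> \<and>
      (\<forall>s\<in>{1..n}. \<forall>t\<in>{1..n}. s \<noteq> t \<longrightarrow> crossing_number w s t \<le> 1))"

definition simple_braids :: "nat \<Rightarrow> braid set" where
  "simple_braids n = {b. \<exists>\<alpha>. \<alpha> permutes {1..n} \<and> permutation_braid n \<alpha> b}"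


section \<open>Resolution trees\<close>

datatype 'a bintree =
  is_leaf: Leaf (label: 'a)
| Node (label: 'a) (left: "'a bintree") (right: "'a bintree")

primrec leaf_labels :: "'a bintree \<Rightarrow> 'a set" where
  "leaf_labels (Leaf b) = {b}"
| "leaf_labels (Node b l r) = leaf_labels l \<union> leaf_labels r"

primrec well_resolved :: "nat \<Rightarrow> braid bintree \<Rightarrow> bool" where
  "well_resolved n (Leaf b) \<longleftrightarrow> b \<in> positive_braids n"
| "well_resolved n (Node b l r) \<longleftrightarrow> b \<in> positive_braids n \<and>
    (\<exists>p\<in>positive_braids n. \<exists>q\<in>positive_braids n. \<exists>i\<in>{1..<n}.
      b = p \<otimes>\<^bsub>braid_group n\<^esub> braid_gen n i [^]\<^bsub>braid_group n\<^esub> (2::nat) \<otimes>\<^bsub>braid_group n\<^esub> q \<and>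
      label l = p \<otimes>\<^bsub>braid_group n\<^esub> q \<and>
      label r = p \<otimes>\<^bsub>braid_group n\<^esub> braid_gen n i \<otimes>\<^bsub>braid_group n\<^esub> q) \<and>
    well_resolved n l \<and> well_resolved n r"

definition resolution_tree :: "nat \<Rightarrow> braid \<Rightarrow> braid bintree \<Rightarrow> bool" where
  "resolution_tree n b t \<longleftrightarrow> well_resolved n t \<and> label t = b"

definition simple_resolution_tree :: "nat \<Rightarrow> braid \<Rightarrow> braid bintree \<Rightarrow> bool" where
  "simple_resolution_tree n b t \<longleftrightarrow> resolution_tree n b t \<and> leaf_labels t \<subseteq> simple_braids n"


section \<open>Oriented links\<close>

text \<open>
  An oriented link diagram in general position with respect to the height function is read upwards
  as a list of events. \<open>Cup k d\<close> is a local minimum with \<open>k\<close> strands to its left, whose new strands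
  at (0-based) positions \<open>k\<close> and \<open>k + 1\<close> are oriented upwards iff \<open>d\<close> and iff \<open>\<not> d\<close>, respectively;
  \<open>Cap k\<close> is a local maximum joining the strands at positions \<open>k\<close> and \<open>k + 1\<close>; \<open>Cross k s\<close> is a
  crossing of these strands, where the strand passing from the lower left to the upper right lies
  over the other one iff \<open>s\<close>.
\<close>

datatype event = Cup nat bool | Cap nat | Cross nat bool

text \<open>A level of a diagram is described by the list of its strands, \<open>True\<close> meaning upwards.\<close>

fun event_step :: "event \<Rightarrow> bool list \<Rightarrow> bool list option" where
  "event_step (Cup k d) xs =
    (if k \<le> length xs then Some (take k xs @ [d, \<not> d] @ drop k xs) else None)"
| "event_step (Cap k) xs =
    (if Suc k < length xs \<and> xs ! k \<noteq> xs ! Suc k then Some (take k xs @ drop (k + 2) xs) else None)"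
| "event_step (Cross k s) xs =
    (if Suc k < length xs then Some (take k xs @ [xs ! Suc k, xs ! k] @ drop (k + 2) xs) else None)"

fun events_run :: "event list \<Rightarrow> bool list \<Rightarrow> bool list option" where
  "events_run [] xs = Some xs"
| "events_run (a # D) xs = Option.bind (event_step a xs) (events_run D)"

definition link_diagram :: "event list \<Rightarrow> bool" where
  "link_diagram D \<longleftrightarrow> events_run D [] = Some []"

fun pos :: "event \<Rightarrow> nat" where
  "pos (Cup k d) = k"
| "pos (Cap k) = k"
| "pos (Cross k s) = k"

fun at_pos :: "event \<Rightarrow> nat \<Rightarrow> event" where
  "at_pos (Cup k d) l = Cup l d"
| "at_pos (Cap k) l = Cap l"
| "at_pos (Cross k s) l = Cross l s"

fun arity_in :: "event \<Rightarrow> nat" where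
  "arity_in (Cup k d) = 0"
| "arity_in (Cap k) = 2"
| "arity_in (Cross k s) = 2"

fun arity_out :: "event \<Rightarrow> nat" where
  "arity_out (Cup k d) = 2"
| "arity_out (Cap k) = 0"
| "arity_out (Cross k s) = 2"

text \<open>
  The moves for diagrams in this form: interchanging the heights of two events that lie side by
  side, cancelling a maximum with a minimum, passing a strand across an extremum (these three
  generate planar isotopy), and the three Reidemeister moves. The side condition of the third
  Reidemeister move says that one strand is above and another one below both others.
\<close>

inductive diagram_move :: "event list \<Rightarrow> event list \<Rightarrow> bool" where
  interchange: "pos a + arity_out a \<le> pos c \<Longrightarrow>
    diagram_move [a, c] [at_pos c (pos c + arity_in a - arity_out a), a]"
| zigzag_left: "diagram_move [Cup (Suc k) d, Cap k] []"
| zigzag_right: "diagram_move [Cup k d, Cap (Suc k)] []"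
| cup_slide: "diagram_move [Cup k d, Cross (Suc k) s] [Cup (Suc k) d, Cross k (\<not> s)]"
| cap_slide: "diagram_move [Cross (Suc k) s, Cap k] [Cross k (\<not> s), Cap (Suc k)]"
| R1_cup: "diagram_move [Cup k d, Cross k s] [Cup k (\<not> d)]"
| R1_cap: "diagram_move [Cross k s, Cap k] [Cap k]"
| R2: "diagram_move [Cross k s, Cross k (\<not> s)] []"
| R3: "s = s' \<or> s' = s'' \<Longrightarrow>
    diagram_move [Cross k s, Cross (Suc k) s', Cross k s'']
                 [Cross (Suc k) s'', Cross k s', Cross (Suc k) s]"

inductive isotopic :: "event list \<Rightarrow> event list \<Rightarrow> bool" where
  refl: "link_diagram D \<Longrightarrow> isotopic D D"
| move: "diagram_move A B \<Longrightarrow> link_diagram (D @ A @ E) \<Longrightarrow> link_diagram (D @ B @ E) \<Longrightarrow>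
    isotopic (D @ A @ E) (D @ B @ E)"
| sym: "isotopic D E \<Longrightarrow> isotopic E D"
| trans: "isotopic D E \<Longrightarrow> isotopic E F \<Longrightarrow> isotopic D F"

lemma isotopic_link_diagram: "isotopic D E \<Longrightarrow> link_diagram D \<and> link_diagram E"
  by (induction rule: isotopic.induct) auto

text \<open>Isotopy classes of oriented links (including the empty link).\<close>

quotient_type oriented_link = "event list" / partial: isotopic
  morphisms rep_link link_of
proof (rule part_equivpI)
  show "\<exists>D. isotopic D D"
    by (rule exI[of _ "[]"]) (simp add: isotopic.refl link_diagram_def)
qed (auto intro: sympI transpI isotopic.sym isotopic.trans)

definition unknot :: oriented_link where
  "unknot = link_of [Cup 0 True, Cap 0]"

text \<open>
  The \<open>n\<close> braid strands run upwards, the closing arcs are nested and run downwards to their right.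
  The braid word is read upwards.
\<close>

definition closure_diagram :: "nat \<Rightarrow> braid_word \<Rightarrow> event list" where
  "closure_diagram n w =
    map (\<lambda>k. Cup k True) [0..<n] @ map (\<lambda>(i, e). Cross (i - 1) e) w @ map Cap (rev [0..<n])"

definition braid_closure :: "nat \<Rightarrow> braid \<Rightarrow> oriented_link" where
  "braid_closure n b = link_of (closure_diagram n (SOME w. w \<in> b))"

lemma events_run_append:
  "events_run (D @ E) xs = Option.bind (events_run D xs) (events_run E)"
proof (induction D arbitrary: xs)
  case (Cons a D)
  then show ?case by (cases "event_step a xs") auto
qed simp

lemma events_run_cups:
  "events_run (map (\<lambda>k. Cup k True) [0..<n]) [] = Some (replicate n True @ replicate n False)"
  by (induction n) (auto simp: events_run_append replicate_append_same)

lemma events_run_caps: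
  "events_run (map Cap (rev [0..<n])) (replicate n True @ replicate n False) = Some []"
proof (induction n)
  case (Suc n)
  have "event_step (Cap n) (replicate (Suc n) True @ replicate (Suc n) False) =
      Some (replicate n True @ replicate n False)"
    by (simp add: nth_append del: replicate_Suc)
  with Suc show ?case by (simp del: event_step.simps replicate_Suc)
qed simp

lemma events_run_braid_word:
  "w \<in> braid_words n \<Longrightarrow>
    events_run (map (\<lambda>(i, e). Cross (i - 1) e) w) (replicate n True @ ys) =
      Some (replicate n True @ ys)"
proof (induction w)
  case (Cons a w)
  obtain i e where a: "a = (i, e)" by (cases a)
  obtain m where m: "i = Suc m" using Cons.prems by (cases i) (auto simp: a)
  then obtain r where r: "n = m + (2 + r)"
    using Cons.prems less_imp_Suc_add[of i n] by (auto simp: a)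
  have "replicate n True @ ys = replicate m True @ True # True # replicate r True @ ys"
    by (simp only: r replicate_add numeral_2_eq_2 replicate_Suc replicate_0 append_Nil append_Cons append_assoc)
  then have "event_step (Cross (i - 1) e) (replicate n True @ ys) = Some (replicate n True @ ys)"
    by (simp add: m nth_append del: replicate_app_Cons_same)
  with Cons show ?case by (simp add: a del: event_step.simps)
qed simp

lemma link_diagram_closure: "w \<in> braid_words n \<Longrightarrow> link_diagram (closure_diagram n w)"
  by (simp add: link_diagram_def closure_diagram_def events_run_append events_run_cups
      events_run_caps events_run_braid_word del: One_nat_def)

lemma isotopic_closure_diagram:
  "braid_equiv n x y \<Longrightarrow> isotopic (closure_diagram n x) (closure_diagram n y)"
proof (induction rule: braid_equiv.induct)
  case (refl w)
  then show ?case by (intro isotopic.refl link_diagram_closure)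
next
  case (step x y u v)
  let ?f = "map (\<lambda>(i, e). Cross (i - 1) e)"
  have move: "diagram_move (?f x) (?f y)"
    using step(1)
  proof cases
    case (cancel i e)
    then show ?thesis using diagram_move.R2 by simp
  next
    case (commute i j)
    then show ?thesis
      using diagram_move.interchange[of "Cross (i - 1) True" "Cross (j - 1) True"] by simp
  next
    case (braid i)
    then show ?thesis
      using diagram_move.R3[of True True True "i - 1"] by simp
  qed
  have "u @ x @ v \<in> braid_words n" "u @ y @ v \<in> braid_words n"
    using step braid_relation_words by auto
  then have "link_diagram (closure_diagram n (u @ x @ v))" "link_diagram (closure_diagram n (u @ y @ v))"
    by (simp_all only: link_diagram_closure)
  then show ?case
    using isotopic.move[OF move, of "map (\<lambda>k. Cup k True) [0..<n] @ ?f u"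
        "?f v @ map Cap (rev [0..<n])"]
    by (simp add: closure_diagram_def)
qed (auto intro: isotopic.sym isotopic.trans)

lemma braid_closure_class:
  assumes "w \<in> braid_words n"
  shows "braid_closure n (braid_class n w) = link_of (closure_diagram n w)"
proof -
  have "w \<in> braid_class n w"
    using assms by (simp add: in_braid_class braid_equiv.refl)
  then have "(SOME x. x \<in> braid_class n w) \<in> braid_class n w"
    by (rule someI)
  then have "isotopic (closure_diagram n (SOME x. x \<in> braid_class n w)) (closure_diagram n w)"
    by (auto simp: in_braid_class intro: isotopic_closure_diagram isotopic.sym)
  then show ?thesis
    unfolding braid_closure_def
    by (metis Quotient3_oriented_link Quotient3_rel)
qed


section \<open>The Homflypt polynomial\<close>

text \<open>
  The Laurent polynomial ring in \<open>v\<close> and \<open>z\<close> over the integers is the group ring of the group of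
  exponent pairs.
\<close>

type_synonym laurent = "(int \<times> int) \<Rightarrow>\<^sub>0 int"

definition laurent_monom :: "int \<Rightarrow> int \<Rightarrow> laurent" where
  "laurent_monom i j = Poly_Mapping.single (i, j) 1"

definition max_v_degree :: "laurent \<Rightarrow> int" where
  "max_v_degree p = Max (fst ` Poly_Mapping.keys p)"

text \<open>
  The crossing \<open>Cross k True\<close> is positive if both strands run upwards or both run downwards, and
  negative otherwise. In the second case, the oriented smoothing consists of a maximum and a minimum.
\<close>

inductive skein_triple :: "event list \<Rightarrow> event list \<Rightarrow> event list \<Rightarrow> bool" where
  parallel:
    "events_run D [] = Some xs \<Longrightarrow> Suc k < length xs \<Longrightarrow> xs ! k = xs ! Suc k \<Longrightarrow>
     link_diagram (D @ [Cross k True] @ E) \<Longrightarrow>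
     skein_triple (D @ [Cross k True] @ E) (D @ [Cross k False] @ E) (D @ E)"
| antiparallel:
    "events_run D [] = Some xs \<Longrightarrow> Suc k < length xs \<Longrightarrow> xs ! k \<noteq> xs ! Suc k \<Longrightarrow>
     link_diagram (D @ [Cross k False] @ E) \<Longrightarrow>
     skein_triple (D @ [Cross k False] @ E) (D @ [Cross k True] @ E)
       (D @ [Cap k, Cup k (xs ! Suc k)] @ E)"

definition homflypt :: "(oriented_link \<Rightarrow> laurent) \<Rightarrow> bool" where
  "homflypt P \<longleftrightarrow> P unknot = 1 \<and>
    (\<forall>Dp Dm D0. skein_triple Dp Dm D0 \<longrightarrow>
      laurent_monom (-1) 0 * P (link_of Dp) - laurent_monom 1 0 * P (link_of Dm) =
      laurent_monom 0 1 * P (link_of D0))"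

lemma skein_triple_link_diagram:
  assumes "skein_triple Dp Dm D0"
  shows "link_diagram Dp \<and> link_diagram Dm \<and> link_diagram D0"
  using assms
proof cases
  case (parallel D xs k E)
  then have "take k xs @ [xs ! Suc k, xs ! k] @ drop (k + 2) xs = xs"
    using id_take_nth_drop[of k xs] Cons_nth_drop_Suc[of "Suc k" xs] by simp
  with parallel show ?thesis
    by (simp add: link_diagram_def events_run_append)
next
  case (antiparallel D xs k E)
  then have "event_step (Cross k s) xs = Some (take k xs @ [xs ! Suc k, xs ! k] @ drop (k + 2) xs)" for s
    by simp
  moreover have "k \<le> length xs - 2"
    using antiparallel by linarith
  then have "events_run ([Cap k, Cup k (xs ! Suc k)] @ E) xs =
      events_run E (take k xs @ [xs ! Suc k, xs ! k] @ drop (k + 2) xs)"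
    using antiparallel by (simp add: min_absorb2)
  ultimately show ?thesis
    using antiparallel
    by (simp add: link_diagram_def events_run_append[of D] del: event_step.simps)
qed

end

theory Submission
  imports Defs Complex_Main
begin

text \<open>
  Reading a positive word from left to right and pushing letters into descending runs, one either
  meets a square \<open>\<sigma>\<^sub>i\<^sup>2\<close> or arrives at the normal form of a simple braid; since a square can be resolved
  into shorter words, this gives simple resolution trees. A normal form in \<open>B\<^sub>n\<close> contains the last
  generator at most once. If it occurs, destabilisation gives a positive braid of smaller writhe on
  \<open>n - 1\<close> strands; otherwise an unlinked strand splits off. By induction the
  Morton-Franks-Williams bound holds for positive braids, and it is strict for simple braids other
  than the identity. The closure of the identity attains the bound, with a top coefficient whose
  sign depends only on \<open>n\<close>, so in a resolution tree the contributions of the identity leaves cannot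
  cancel. As \<open>max_v_degree 0\<close> is unspecified, one also needs that the polynomial is nonzero: its value
  on the curve \<open>z = v\<^sup>-\<^sup>1 - v\<close> is 1.
\<close>

section \<open>Positive words and their staircase form\<close>

abbreviation pos_word :: "nat list \<Rightarrow> braid_word" where
  "pos_word is \<equiv> map (\<lambda>i. (i, True)) is"

abbreviation word_equiv :: "nat \<Rightarrow> nat list \<Rightarrow> nat list \<Rightarrow> bool" where
  "word_equiv n x y \<equiv> braid_equiv n (pos_word x) (pos_word y)"

lemma pos_word_in_braid_words [simp]: "pos_word is \<in> braid_words n \<longleftrightarrow> set is \<subseteq> {1..<n}"
  by (induction "is") auto

lemma positive_wordE:
  assumes "positive_word w" obtains "is" where "w = pos_word is"
proof
  show "w = pos_word (map fst w)"
    using assms by (induction w) (auto simp: positive_word_def)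
qed

lemma positive_word_pos_word [simp]: "positive_word (pos_word is)"
  by (auto simp: positive_word_def)

lemma word_equiv_set: "word_equiv n x y \<Longrightarrow> set x \<subseteq> {1..<n} \<and> set y \<subseteq> {1..<n}"
  using braid_equiv_words by (metis pos_word_in_braid_words)

lemma word_equiv_refl: "set x \<subseteq> {1..<n} \<Longrightarrow> word_equiv n x x"
  by (rule braid_equiv.refl) simp

lemma exponent_sum_pos_word: "exponent_sum (pos_word x) = int (length x)"
  by (induction x) (auto simp: exponent_sum_def)

lemma word_equiv_length: "word_equiv n x y \<Longrightarrow> length x = length y"
  using exponent_sum_equiv exponent_sum_pos_word by (metis of_nat_eq_iff)

lemma word_equiv_append:
  "word_equiv n x x' \<Longrightarrow> word_equiv n y y' \<Longrightarrow> word_equiv n (x @ y) (x' @ y')"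
  using braid_equiv_append by simp

lemma braid_relation_mono: "braid_relation m x y \<Longrightarrow> m \<le> n \<Longrightarrow> braid_relation n x y"
  by (induction rule: braid_relation.induct) (auto intro: braid_relation.intros)

lemma braid_words_mono: "x \<in> braid_words m \<Longrightarrow> m \<le> n \<Longrightarrow> x \<in> braid_words n"
  by (induction x) auto

lemma braid_equiv_mono: "braid_equiv m x y \<Longrightarrow> m \<le> n \<Longrightarrow> braid_equiv n x y"
  by (induction rule: braid_equiv.induct)
    (auto intro: braid_equiv.intros braid_relation_mono braid_words_mono)

lemma word_equiv_commute:
  assumes "i \<in> {1..<n}" "j \<in> {1..<n}" "i + 2 \<le> j \<or> j + 2 \<le> i"
  shows "word_equiv n [i, j] [j, i]"
  using assms braid_equiv.step[of n _ _ "[]" "[]"] braid_relation.commute[of _ n]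
  by (auto intro: braid_equiv.sym)

lemma word_equiv_braid:
  assumes "i \<in> {1..<n}" "Suc i \<in> {1..<n}"
  shows "word_equiv n [i, Suc i, i] [Suc i, i, Suc i]"
  using assms braid_equiv.step[of n _ _ "[]" "[]"] braid_relation.braid[of i n] by simp

lemma word_equiv_commute_word:
  assumes "i \<in> {1..<n}" "set x \<subseteq> {1..<n}" "\<forall>j\<in>set x. i + 2 \<le> j \<or> j + 2 \<le> i"
  shows "word_equiv n (x @ [i]) (i # x)"
  using assms(2,3)
proof (induction x)
  case Nil
  then show ?case using assms by (simp add: word_equiv_refl[of "[i]", simplified])
next
  case (Cons j x)
  have "word_equiv n ([j] @ (x @ [i])) ([j] @ (i # x))"
    using Cons by (intro word_equiv_append word_equiv_refl) auto
  moreover have "word_equiv n ([j, i] @ x) ([i, j] @ x)"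
    using Cons assms(1) by (intro word_equiv_append word_equiv_refl word_equiv_commute) auto
  ultimately show ?case by (auto intro: braid_equiv.trans)
qed

text \<open>
  The staircase words are the normal forms \<open>u\<^sub>1 u\<^sub>2 \<dots> u\<^sub>n\<^sub>-\<^sub>1\<close> of the simple braids, where \<open>u\<^sub>m\<close> is a
  descending run \<open>\<sigma>\<^sub>m \<sigma>\<^sub>m\<^sub>-\<^sub>1 \<dots> \<sigma>\<^sub>k\<close>.
\<close>

inductive staircase :: "nat \<Rightarrow> nat list \<Rightarrow> bool" where
  one: "staircase (Suc 0) []"
| Suc: "staircase n u \<Longrightarrow> 1 \<le> k \<Longrightarrow> k \<le> Suc n \<Longrightarrow> staircase (Suc n) (u @ rev [k..<Suc n])"

lemma staircase_set: "staircase n u \<Longrightarrow> set u \<subseteq> {1..<n}"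
  by (induction rule: staircase.induct) auto

text \<open>A letter \<open>i\<close> appended to the run from \<open>n\<close> down to
  \<open>k\<close> commutes past it if \<open>i + 2 \<le> k\<close>, prolongs it if
  \<open>k = Suc i\<close>, and makes a square if \<open>i = k\<close>. If \<open>i > k\<close>, it
  passes through the run and comes out in front as \<open>i - 1\<close>. The prefix receives only
  letters below \<open>n\<close>.\<close>

lemma staircase_extend_last:
  assumes u: "set u \<subseteq> {1..<n}" and k: "1 \<le> k" "k \<le> Suc n" and i: "i \<in> {1..<Suc n}"
  shows "(\<exists>x j y. word_equiv (Suc n) (u @ rev [k..<Suc n] @ [i]) (x @ [j, j] @ y)) \<or>
    (\<exists>u' k'. set u' \<subseteq> {1..<n} \<and> 1 \<le> k' \<and> k' \<le> Suc n \<and>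
      word_equiv (Suc n) (u @ rev [k..<Suc n] @ [i]) (u' @ rev [k'..<Suc n]))"
proof -
  have u': "set u \<subseteq> {1..<Suc n}" using u by auto
  consider "i + 2 \<le> k" | "k = Suc i" | "i = k" | "k < i" by linarith
  then show ?thesis
  proof cases
    case 1
    have "word_equiv (Suc n) (u @ rev [k..<Suc n] @ [i]) (u @ i # rev [k..<Suc n])"
      using 1 k i by (intro word_equiv_append word_equiv_refl u' word_equiv_commute_word) auto
    then have "word_equiv (Suc n) (u @ rev [k..<Suc n] @ [i]) ((u @ [i]) @ rev [k..<Suc n])"
      by simp
    moreover have "set (u @ [i]) \<subseteq> {1..<n}" using u 1 k i by auto
    ultimately show ?thesis using k by blast
  next
    case 2
    then have eq: "rev [k..<Suc n] @ [i] = rev [i..<Suc n]"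
      using k by (simp add: upt_conv_Cons[of i])
    have "word_equiv (Suc n) (u @ rev [k..<Suc n] @ [i]) (u @ rev [i..<Suc n])"
      unfolding eq using u' i by (intro word_equiv_refl) auto
    moreover have "1 \<le> i" "i \<le> Suc n" using i by auto
    ultimately show ?thesis using u by blast
  next
    case 3
    then have "rev [k..<Suc n] = rev [Suc k..<Suc n] @ [k]"
      using i by (simp add: upt_conv_Cons[of k])
    then have eq: "u @ rev [k..<Suc n] @ [i] = (u @ rev [Suc k..<Suc n]) @ [k, k] @ []"
      using 3 by simp
    have "word_equiv (Suc n) (u @ rev [k..<Suc n] @ [i]) ((u @ rev [Suc k..<Suc n]) @ [k, k] @ [])"
      unfolding eq using u' k i 3 by (intro word_equiv_refl) auto
    then show ?thesis by blast
  next
    case 4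
    then obtain j where j: "i = Suc j" "k \<le> j" by (cases i) auto
    \<comment> \<open>The run reads \<open>?A\<close>, \<open>i\<close>, \<open>j\<close>,
      \<open>?B\<close>. The new \<open>i\<close> commutes with \<open>?B\<close>, whose letters are
      below \<open>j\<close>; a braid relation turns \<open>i j i\<close> into \<open>j i j\<close>;
      the leading \<open>j\<close> commutes with \<open>?A\<close>, whose letters exceed
      \<open>i\<close>.\<close>
    let ?A = "rev [Suc i..<Suc n]" and ?B = "rev [k..<j]"
    have "[k..<Suc n] = [k..<j] @ [j..<Suc n]"
      using upt_add_eq_append[of k j "Suc n - j"] j i by simp
    also have "[j..<Suc n] = j # i # [Suc i..<Suc n]"
      using j i by (simp add: upt_conv_Cons)
    finally have split: "rev [k..<Suc n] = ?A @ [i, j] @ ?B" by simp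
    have "word_equiv (Suc n) ((u @ ?A @ [i, j]) @ (?B @ [i])) ((u @ ?A @ [i, j]) @ (i # ?B))"
      using j k i u' by (intro word_equiv_append word_equiv_refl word_equiv_commute_word) auto
    moreover have "word_equiv (Suc n) ((u @ ?A) @ [i, j, i] @ ?B) ((u @ ?A) @ [j, i, j] @ ?B)"
      using j k i u' unfolding j(1)
      by (intro word_equiv_append word_equiv_refl braid_equiv.sym[OF word_equiv_braid]) auto
    moreover have "word_equiv (Suc n) (u @ (?A @ [j]) @ ([i, j] @ ?B)) (u @ (j # ?A) @ ([i, j] @ ?B))"
      using j k i u' by (intro word_equiv_append word_equiv_refl word_equiv_commute_word) auto
    ultimately have "word_equiv (Suc n) (u @ rev [k..<Suc n] @ [i]) ((u @ [j]) @ rev [k..<Suc n])"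
      unfolding split
      by (simp del: upt_Suc) (erule braid_equiv.trans, erule braid_equiv.trans, assumption)
    moreover have "set (u @ [j]) \<subseteq> {1..<n}" using u j k i by auto
    ultimately show ?thesis using k by blast
  qed
qed

lemma descending_run_or_square:
  assumes "set w \<subseteq> {1..<Suc n}"
  shows "(\<exists>x j y. word_equiv (Suc n) w (x @ [j, j] @ y)) \<or>
    (\<exists>u k. set u \<subseteq> {1..<n} \<and> 1 \<le> k \<and> k \<le> Suc n \<and> word_equiv (Suc n) w (u @ rev [k..<Suc n]))"
  using assms
proof (induction w rule: rev_induct)
  case Nil
  \<comment> \<open>Starting the run at \<open>Suc n\<close> encodes the empty run.\<close>
  have "word_equiv (Suc n) [] ([] @ rev [Suc n..<Suc n])" by (simp add: braid_equiv.refl)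
  then show ?case by (intro disjI2 exI[of _ "[]"] exI[of _ "Suc n"]) auto
next
  case (snoc i w)
  then have i: "i \<in> {1..<Suc n}" by simp
  then have refl: "word_equiv (Suc n) [i] [i]" by (intro word_equiv_refl) simp
  from snoc consider
    (square) x j y where "word_equiv (Suc n) w (x @ [j, j] @ y)"
    | (run) u k where "set u \<subseteq> {1..<n}" "1 \<le> k" "k \<le> Suc n" "word_equiv (Suc n) w (u @ rev [k..<Suc n])"
    by auto
  then show ?case
  proof cases
    case square
    then show ?thesis
      using word_equiv_append[OF square refl, unfolded append_assoc] by blast
  next
    case run
    note eq = word_equiv_append[OF run(4) refl, unfolded append_assoc]
    show ?thesis
      using staircase_extend_last[OF run(1-3) i] braid_equiv.trans[OF eq] by blast
  qed
qed

text \<open>Once the last run is split off, the prefix is a word on one strand fewer, so induction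
  on \<open>n\<close> applies to it. A square found in the prefix remains a square in the whole
  word.\<close>

lemma staircase_or_square:
  assumes "n \<ge> 1" "set w \<subseteq> {1..<n}"
  obtains x j y where "word_equiv n w (x @ [j, j] @ y)"
  | u where "staircase n u" "word_equiv n w u"
proof -
  have "(\<exists>x j y. word_equiv n w (x @ [j, j] @ y)) \<or> (\<exists>u. staircase n u \<and> word_equiv n w u)"
    using assms
  proof (induction n arbitrary: w rule: dec_induct)
    case base
    then have "staircase (Suc 0) w" "word_equiv (Suc 0) w w"
      using staircase.one by (auto intro: braid_equiv.refl)
    then show ?case by auto
  next
    case (step n)
    from descending_run_or_square[OF step.prems] show ?case
    proof (elim disjE exE conjE)
      fix u k
      assume u: "set u \<subseteq> {1..<n}" and k: "1 \<le> k" "k \<le> Suc n"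
        and w: "word_equiv (Suc n) w (u @ rev [k..<Suc n])"
      have tail: "word_equiv (Suc n) (rev [k..<Suc n]) (rev [k..<Suc n])"
        using k by (intro word_equiv_refl) auto
      have lift: "word_equiv (Suc n) w (u' @ rev [k..<Suc n])" if "word_equiv n u u'" for u'
        using braid_equiv.trans[OF w word_equiv_append[OF braid_equiv_mono[OF that] tail]] by simp
      from step.IH[OF u] show ?thesis
      proof (elim disjE exE conjE)
        fix x j y assume "word_equiv n u (x @ [j, j] @ y)"
        from lift[OF this, unfolded append_assoc] show ?thesis by blast
      next
        fix u' assume "staircase n u'" "word_equiv n u u'"
        then show ?thesis using lift staircase.Suc k by blast
      qed
    qed blast
  qed
  then show thesis using that by blast
qed

section \<open>Crossing numbers\<close>

lemma crossing_number_Nil [simp]: "crossing_number [] s t = 0"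
  by (simp add: crossing_number_def)

lemma crossing_number_Cons [simp]:
  "crossing_number ((i, e) # w) s t = (if {s, t} = {i, Suc i} then 1 else 0) +
    crossing_number w (transpose i (Suc i) s) (transpose i (Suc i) t)"
proof -
  let ?S = "\<lambda>w s t. {m. m < length w \<and>
    {strand_pos (take m w) s, strand_pos (take m w) t} = {fst (w ! m), Suc (fst (w ! m))}}"
  have "?S ((i, e) # w) s t = (if {s, t} = {i, Suc i} then {0} else {}) \<union>
      Suc ` ?S w (transpose i (Suc i) s) (transpose i (Suc i) t)" (is "?L = ?R")
  proof (rule Set.set_eqI)
    fix m show "m \<in> ?L \<longleftrightarrow> m \<in> ?R" by (cases m) auto
  qed
  moreover have "card ?R = (if {s, t} = {i, Suc i} then 1 else 0) +
      card (?S w (transpose i (Suc i) s) (transpose i (Suc i) t))"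
    by (subst card_Un_disjoint) (auto simp: card_image)
  ultimately show ?thesis by (simp add: crossing_number_def)
qed

lemma crossing_number_append:
  "crossing_number (u @ v) s t =
    crossing_number u s t + crossing_number v (strand_pos u s) (strand_pos u t)"
  by (induction u arbitrary: s t) auto

lemma strand_pos_append: "strand_pos (u @ v) = strand_pos v \<circ> strand_pos u"
  by (induction u) (auto simp: o_def)

lemma strand_pos_permutes: "w \<in> braid_words n \<Longrightarrow> strand_pos w permutes {1..n}"
proof (induction w)
  case (Cons a w)
  then show ?case
    by (cases a) (auto simp: o_def[symmetric] intro!: permutes_compose[of "transpose _ _"] permutes_swap_id
      simp del: o_apply)
qed (simp add: permutes_id)

lemma strand_pos_equiv: "braid_equiv n x y \<Longrightarrow> strand_pos x = strand_pos y"
proof (induction rule: braid_equiv.induct)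
  case (step x y u v)
  from step(1) have "strand_pos x = strand_pos y"
    by cases (auto simp: fun_eq_iff transpose_def)
  then show ?case by (simp add: strand_pos_append)
qed auto

text \<open>Every letter of a word is a crossing of exactly one pair of strands, counted here twice.\<close>

lemma sum_crossing_number:
  "w \<in> braid_words n \<Longrightarrow> (\<Sum>s\<in>{1..n}. \<Sum>t\<in>{1..n}. crossing_number w s t) = 2 * length w"
proof (induction w)
  case (Cons a w)
  obtain i e where a: "a = (i, e)" by (cases a)
  have i: "i \<in> {1..<n}" "w \<in> braid_words n" using Cons.prems a by auto
  let ?p = "transpose i (Suc i)"
  have p: "?p permutes {1..n}" using i by (intro permutes_swap_id) auto
  \<comment> \<open>The first letter permutes the starting positions, so both sums can be reindexed
    by \<open>?p\<close>.\<close>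
  have "(\<Sum>s\<in>{1..n}. \<Sum>t\<in>{1..n}. crossing_number w (?p s) (?p t)) =
      (\<Sum>s\<in>{1..n}. \<Sum>t\<in>{1..n}. crossing_number w s t)"
    by (subst sum.permute[OF p], intro sum.cong HOL.refl, subst (2) sum.permute[OF p]) simp
  moreover have "(\<Sum>s\<in>{1..n}. \<Sum>t\<in>{1..n}. if {s, t} = {i, Suc i} then 1 else 0) = (2::nat)"
  proof -
    have "(\<Sum>s\<in>{1..n}. \<Sum>t\<in>{1..n}. if {s, t} = {i, Suc i} then 1 else 0) =
      (\<Sum>(s, t)\<in>{1..n} \<times> {1..n}. if {s, t} = {i, Suc i} then 1 else (0::nat))"
      by (simp add: sum.cartesian_product)
    also have "\<dots> = (\<Sum>(s, t)\<in>{(i, Suc i), (Suc i, i)}. 1)"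
      using i by (intro sum.mono_neutral_cong_right) (auto simp: doubleton_eq_iff split: if_splits)
    finally show ?thesis by simp
  qed
  ultimately show ?case
    using Cons i by (simp add: a sum.distrib)
qed simp

text \<open>A letter reverses the order of two strands exactly when they cross there.\<close>

lemma odd_crossing_number_iff:
  "s \<noteq> t \<Longrightarrow> odd (crossing_number w s t) \<longleftrightarrow> (s < t) \<noteq> (strand_pos w s < strand_pos w t)"
proof (induction w arbitrary: s t)
  case (Cons a w)
  obtain i e where a: "a = (i, e)" by (cases a)
  let ?p = "transpose i (Suc i)"
  have "?p s \<noteq> ?p t" using Cons.prems by (metis transpose_involutory)
  moreover have "(s < t) = (?p s < ?p t) \<longleftrightarrow> {s, t} \<noteq> {i, Suc i}"
    using Cons.prems by (auto simp: transpose_def doubleton_eq_iff)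
  ultimately show ?case using Cons.IH[of "?p s" "?p t"] by (auto simp: a)
qed simp

lemma crossing_number_same [simp]: "crossing_number w s s = 0"
  by (induction w arbitrary: s) (auto simp: doubleton_eq_iff)

text \<open>The strands that \<open>x\<close> brings to positions \<open>j\<close> and
  \<open>Suc j\<close> cross at both letters of the square.\<close>

lemma crossing_number_ge_2_of_square:
  assumes "set (x @ [j, j] @ y) \<subseteq> {1..<n}"
  obtains s t where "s \<in> {1..n}" "t \<in> {1..n}" "s \<noteq> t"
    "2 \<le> crossing_number (pos_word (x @ [j, j] @ y)) s t"
proof -
  have p: "strand_pos (pos_word x) permutes {1..n}"
    using assms by (intro strand_pos_permutes) simp
  obtain s t where st: "s \<in> {1..n}" "t \<in> {1..n}"
    "strand_pos (pos_word x) s = j" "strand_pos (pos_word x) t = Suc j"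
  proof -
    have "j \<in> strand_pos (pos_word x) ` {1..n}" "Suc j \<in> strand_pos (pos_word x) ` {1..n}"
      using assms by (simp_all only: permutes_image[OF p]) auto
    then show ?thesis using that by auto
  qed
  then have "s \<noteq> t" by auto
  moreover have "2 \<le> crossing_number (pos_word (x @ [j, j] @ y)) s t"
    using st by (simp add: crossing_number_append insert_commute)
  ultimately show thesis using that st by blast
qed

text \<open>
  Since the permutation determines the parities of the crossing numbers, a word whose crossing
  numbers are at most 1 is shorter than any other word with the same permutation in which two
  strands cross twice.
\<close>

lemma simple_word_no_square:
  assumes w: "w \<in> braid_words n"
    and simple: "\<And>s t. s \<in> {1..n} \<Longrightarrow> t \<in> {1..n} \<Longrightarrow> s \<noteq> t \<Longrightarrow> crossing_number w s t \<le> 1"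
    and equiv: "braid_equiv n w (pos_word (x @ [j, j] @ y))" (is "braid_equiv n w ?v")
  shows "length w < length (x @ [j, j] @ y)"
proof -
  have v: "?v \<in> braid_words n" using braid_equiv_words[OF equiv] by blast
  \<comment> \<open>Both numbers have the same parity and the left one is 0 or 1.\<close>
  have le: "crossing_number w s t \<le> crossing_number ?v s t" if "s \<in> {1..n}" "t \<in> {1..n}" for s t
  proof (cases "s = t")
    case False
    then have "odd (crossing_number w s t) \<longleftrightarrow> odd (crossing_number ?v s t)"
      by (simp only: strand_pos_equiv[OF equiv] odd_crossing_number_iff[OF False])
    then show ?thesis using simple[OF that False]
      by (cases "crossing_number ?v s t = 0") auto
  qed simp
  obtain s t where st: "s \<in> {1..n}" "t \<in> {1..n}" "s \<noteq> t" "2 \<le> crossing_number ?v s t"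
    using crossing_number_ge_2_of_square v pos_word_in_braid_words by blast
  have "(\<Sum>s\<in>{1..n}. \<Sum>t\<in>{1..n}. crossing_number w s t) <
      (\<Sum>s\<in>{1..n}. \<Sum>t\<in>{1..n}. crossing_number ?v s t)"
  proof (rule sum_strict_mono_ex1)
    show "\<exists>s\<in>{1..n}. (\<Sum>t\<in>{1..n}. crossing_number w s t) < (\<Sum>t\<in>{1..n}. crossing_number ?v s t)"
    proof (intro bexI[OF _ st(1)], rule sum_strict_mono_ex1)
      show "\<exists>t\<in>{1..n}. crossing_number w s t < crossing_number ?v s t"
        using simple[OF st(1-3)] st by (intro bexI[OF _ st(2)]) linarith
    qed (use le st in auto)
  qed (use le in \<open>auto intro!: sum_mono\<close>)
  then show ?thesis
    using sum_crossing_number[OF w] sum_crossing_number[OF v] by simp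
qed

section \<open>Crossing numbers of staircase words\<close>

lemma crossing_number_eq_0:
  "set w \<subseteq> {..<n} \<Longrightarrow> n < s \<or> n < t \<Longrightarrow> crossing_number (pos_word w) s t = 0"
proof (induction w arbitrary: s t)
  case (Cons i w)
  then have "{s, t} \<noteq> {i, Suc i}"
    "n < transpose i (Suc i) s \<or> n < transpose i (Suc i) t"
    by (auto simp: doubleton_eq_iff transpose_def)
  with Cons show ?case by simp
qed simp

lemma strand_pos_fix: "set w \<subseteq> {..<n} \<Longrightarrow> n < s \<Longrightarrow> strand_pos (pos_word w) s = s"
  by (induction w) (auto simp: transpose_def)

text \<open>In the run from \<open>m\<close> down to \<open>k\<close> the strand starting at
  \<open>Suc m\<close> moves to the left, passing the others one after another; no other crossings
  occur.\<close>

lemma crossing_number_descending_run: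
  shows "s \<noteq> Suc m \<Longrightarrow> t \<noteq> Suc m \<Longrightarrow> crossing_number (pos_word (rev [k..<Suc m])) s t = 0"
    and "crossing_number (pos_word (rev [k..<Suc m])) s t \<le> 1"
proof (induction m arbitrary: s t)
  case 0
  { case 1 then show ?case by (auto simp: doubleton_eq_iff)
  next case 2 then show ?case by auto }
next
  case (Suc m)
  have zero: "crossing_number (pos_word (rev [k..<Suc (Suc m)])) s t = 0"
    if "s \<noteq> Suc (Suc m)" "t \<noteq> Suc (Suc m)" for s t
    using Suc.IH(1)[of "transpose (Suc m) (Suc (Suc m)) s" "transpose (Suc m) (Suc (Suc m)) t"] that
    by (auto simp: doubleton_eq_iff transpose_def)
  { case 1 then show ?case by (rule zero)
  next
    case 2
    \<comment> \<open>After the first letter has crossed the two rightmost strands, one of them sits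
      at \<open>Suc (Suc m)\<close>, out of reach of the rest of the run.\<close>
    have "set (rev [k..<Suc m]) \<subseteq> {..<Suc m}" by auto
    from crossing_number_eq_0[OF this] have
      "crossing_number (pos_word (rev [k..<Suc m])) (Suc m) (Suc (Suc m)) = 0"
      "crossing_number (pos_word (rev [k..<Suc m])) (Suc (Suc m)) (Suc m) = 0" by auto
    then show ?case
      using Suc.IH(2)[of "transpose (Suc m) (Suc (Suc m)) s" "transpose (Suc m) (Suc (Suc m)) t"]
      by (auto simp: doubleton_eq_iff simp del: upt_Suc) (auto simp: upt_Suc doubleton_eq_iff) }
qed

text \<open>The prefix leaves the last strand alone, while every crossing in the final run involves
  it. So a given pair crosses in only one of the two parts.\<close>

lemma staircase_crossing_number:
  "staircase n u \<Longrightarrow> crossing_number (pos_word u) s t \<le> 1"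
proof (induction arbitrary: s t rule: staircase.induct)
  case (Suc n u k)
  have u: "set u \<subseteq> {..<n}" using staircase_set[OF Suc.hyps(1)] by auto
  show ?case
  proof (cases "s = Suc n \<or> t = Suc n")
    case True
    then show ?thesis
      using crossing_number_eq_0[OF u, of s t] crossing_number_descending_run(2)
      by (auto simp: crossing_number_append simp del: upt_Suc)
  next
    case False
    \<comment> \<open>Injectivity: as \<open>u\<close> fixes \<open>Suc n\<close>, no other strand
      arrives there.\<close>
    have "strand_pos (pos_word u) r = Suc n \<longleftrightarrow> r = Suc n" for r
      using strand_pos_fix[OF u, of "Suc n"] permutes_inj[OF strand_pos_permutes[of "pos_word u" n]]
        staircase_set[OF Suc.hyps(1)]
      by (metis injD lessI pos_word_in_braid_words)
    then show ?thesis
      using False Suc.IH crossing_number_descending_run(1)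
      by (simp add: crossing_number_append del: upt_Suc)
  qed
qed simp

section \<open>Destabilisation\<close>

lemma diagram_move_isotopic:
  assumes "link_diagram (D @ A @ E)" "link_diagram (D @ B @ E)" "diagram_move A B \<or> diagram_move B A"
  shows "isotopic (D @ A @ E) (D @ B @ E)"
  using assms by (auto intro: isotopic.move isotopic.sym)

abbreviation cups :: "nat \<Rightarrow> event list" where
  "cups n \<equiv> map (\<lambda>k. Cup k True) [0..<n]"

abbreviation caps :: "nat \<Rightarrow> event list" where
  "caps n \<equiv> map Cap (rev [0..<n])"

abbreviation crossings :: "braid_word \<Rightarrow> event list" where
  "crossings w \<equiv> map (\<lambda>(i, e). Cross (i - 1) e) w"

text \<open>The four choices of \<open>K\<close> are the stages in which
  \<open>isotopic_kink\<close> removes the loop; each leads back to the level from which it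
  starts.\<close>

lemma events_run_kink:
  assumes "n \<ge> 1" and "K \<in> {[Cup n True, Cross (n - 1) e, Cap n], [Cup (n - 1) True, Cross n e, Cap n],
      [Cup (n - 1) True, Cap n], []}"
  shows "events_run K (replicate n True @ replicate n False) = Some (replicate n True @ replicate n False)"
proof -
  obtain m where n: "n = Suc m" using assms(1) by (cases n) auto
  have "replicate n True @ replicate n False = replicate m True @ True # replicate n False"
    by (simp add: n replicate_app_Cons_same)
  then show ?thesis
    using assms(2) by (auto simp: n nth_append nth_Cons' simp del: replicate_app_Cons_same replicate.simps)
qed

lemma link_diagram_kink:
  assumes "n \<ge> 1" "x \<in> braid_words n" "y \<in> braid_words n"
    and "K \<in> {[Cup n True, Cross (n - 1) e, Cap n], [Cup (n - 1) True, Cross n e, Cap n],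
      [Cup (n - 1) True, Cap n], []}"
  shows "link_diagram (cups n @ crossings x @ K @ crossings y @ caps n)"
  using assms(2,3) events_run_kink[OF assms(1,4)]
  by (simp add: link_diagram_def events_run_append events_run_cups events_run_caps
      events_run_braid_word del: events_run.simps One_nat_def)

text \<open>The loop of the last strand is pulled in through the crossing and then removed.\<close>

lemma isotopic_kink:
  assumes "n \<ge> 1" "x \<in> braid_words n" "y \<in> braid_words n"
  shows "isotopic (cups n @ crossings x @ [Cup n True, Cross (n - 1) e, Cap n] @ crossings y @ caps n)
    (closure_diagram n (x @ y))"
proof -
  obtain m where n: "n = Suc m" using assms(1) by (cases n) auto
  let ?D = "cups n @ crossings x" and ?E = "crossings y @ caps n"
  have link: "link_diagram (?D @ K @ ?E)"
    if "K \<in> {[Cup n True, Cross (n - 1) e, Cap n], [Cup (n - 1) True, Cross n (\<not> e), Cap n],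
      [Cup (n - 1) True, Cap n], []}" for K
    using link_diagram_kink[OF assms, of K e] link_diagram_kink[OF assms, of K "\<not> e"] that by auto
  \<comment> \<open>\<open>cup_slide\<close> is applied from right to left, which negates the
    crossing flag.\<close>
  have "isotopic (?D @ [Cup n True, Cross (n - 1) e] @ Cap n # ?E)
      (?D @ [Cup (n - 1) True, Cross n (\<not> e)] @ Cap n # ?E)"
    using link[of "[Cup n True, Cross (n - 1) e, Cap n]"]
      link[of "[Cup (n - 1) True, Cross n (\<not> e), Cap n]"]
      diagram_move.cup_slide[of m True "\<not> e"]
    by (intro diagram_move_isotopic) (simp_all add: n)
  moreover have "isotopic ((?D @ [Cup (n - 1) True]) @ [Cross n (\<not> e), Cap n] @ ?E)
      ((?D @ [Cup (n - 1) True]) @ [Cap n] @ ?E)"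
    using link[of "[Cup (n - 1) True, Cross n (\<not> e), Cap n]"] link[of "[Cup (n - 1) True, Cap n]"]
      diagram_move.R1_cap[of n "\<not> e"]
    by (intro diagram_move_isotopic) simp_all
  moreover have "isotopic (?D @ [Cup (n - 1) True, Cap n] @ ?E) (?D @ [] @ ?E)"
    using link[of "[Cup (n - 1) True, Cap n]"] link[of "[]"]
      diagram_move.zigzag_right[of m True]
    by (intro diagram_move_isotopic) (simp_all add: n)
  ultimately show ?thesis
    by (auto simp: closure_diagram_def intro: isotopic.trans)
qed

text \<open>Interpolates between two diagrams: for empty \<open>x\<close> and \<open>y'\<close> it
  is the closure of \<open>x' @ [(n, e)] @ y\<close> on \<open>Suc n\<close> strands; for empty
  \<open>x'\<close> and \<open>y\<close> the closing arc of the last strand has shrunk to a small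
  loop at the crossing.\<close>

definition kinked :: "nat \<Rightarrow> braid_word \<Rightarrow> braid_word \<Rightarrow> bool \<Rightarrow> braid_word \<Rightarrow> braid_word \<Rightarrow> event list" where
  "kinked n x x' e y y' = cups n @ crossings x @ [Cup n True] @ crossings x' @ [Cross (n - 1) e] @
    crossings y @ [Cap n] @ crossings y' @ caps n"

lemma link_diagram_kinked:
  assumes "n \<ge> 1" "x \<in> braid_words n" "x' \<in> braid_words n" "y \<in> braid_words n" "y' \<in> braid_words n"
  shows "link_diagram (kinked n x x' e y y')"
proof -
  obtain m where n: "n = Suc m" using assms(1) by (cases n) auto
  let ?S = "replicate n True @ replicate n False"
    and ?T = "replicate n True @ [True, False] @ replicate n False"
  have "?T = replicate m True @ [True, True, False] @ replicate n False"
    by (simp add: n replicate_app_Cons_same)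
  then have "events_run [Cup n True] ?S = Some ?T" "events_run [Cross (n - 1) e] ?T = Some ?T"
    "events_run [Cap n] ?T = Some ?S"
    by (auto simp: n nth_append nth_Cons' simp del: replicate_app_Cons_same replicate.simps)
  then show ?thesis
    using assms(2-)
    by (simp add: link_diagram_def events_run_append events_run_cups events_run_caps
      events_run_braid_word kinked_def del: events_run.simps append_Cons append_Nil One_nat_def)
qed

text \<open>The letters of \<open>x'\<close> lie to the left of the minimum
  \<open>Cup n True\<close>, so they can be moved below it one by one. The same holds above the
  crossing for \<open>y\<close> and the maximum.\<close>

lemma isotopic_kinked_left:
  assumes "n \<ge> 1" "x \<in> braid_words n" "x' \<in> braid_words n" "y \<in> braid_words n" "y' \<in> braid_words n"
  shows "isotopic (kinked n x x' e y y') (kinked n (x @ x') [] e y y')"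
  using assms(2,3)
proof (induction x' arbitrary: x)
  case Nil
  then show ?case using link_diagram_kinked[OF assms(1) _ _ assms(4,5)] by (simp add: isotopic.refl)
next
  case (Cons a x')
  obtain i d where a: "a = (i, d)" by (cases a)
  have i: "1 \<le> i" "i < n" using Cons.prems a by auto
  then have "diagram_move [Cross (i - 1) d, Cup n True] [Cup n True, Cross (i - 1) d]"
    using diagram_move.interchange[of "Cross (i - 1) d" "Cup n True"] by simp
  moreover have "link_diagram (kinked n x (a # x') e y y')" "link_diagram (kinked n (x @ [a]) x' e y y')"
    using Cons.prems assms(1,4,5) by (auto intro!: link_diagram_kinked)
  ultimately have "isotopic (kinked n x (a # x') e y y') (kinked n (x @ [a]) x' e y y')"
    using diagram_move_isotopic[of "cups n @ crossings x" "[Cup n True, Cross (i - 1) d]"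
       "crossings x' @ [Cross (n - 1) e] @ crossings y @ [Cap n] @ crossings y' @ caps n"
       "[Cross (i - 1) d, Cup n True]"]
    by (simp add: a kinked_def)
  moreover have "isotopic (kinked n (x @ [a]) x' e y y') (kinked n ((x @ [a]) @ x') [] e y y')"
    using Cons.prems a by (intro Cons.IH) auto
  ultimately show ?case by (auto intro: isotopic.trans)
qed

lemma isotopic_kinked_right:
  assumes "n \<ge> 1" "x \<in> braid_words n" "y \<in> braid_words n" "y' \<in> braid_words n"
  shows "isotopic (kinked n x [] e y y') (kinked n x [] e [] (y @ y'))"
  using assms(3,4)
proof (induction y arbitrary: y' rule: rev_induct)
  case Nil
  then show ?case using link_diagram_kinked[OF assms(1,2)] by (simp add: isotopic.refl)
next
  case (snoc a y)
  obtain i d where a: "a = (i, d)" by (cases a)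
  have i: "1 \<le> i" "i < n" using snoc.prems a by auto
  then have "diagram_move [Cross (i - 1) d, Cap n] [Cap n, Cross (i - 1) d]"
    using diagram_move.interchange[of "Cross (i - 1) d" "Cap n"] by simp
  moreover have "link_diagram (kinked n x [] e (y @ [a]) y')" "link_diagram (kinked n x [] e y (a # y'))"
    using snoc.prems assms(1,2) by (auto intro!: link_diagram_kinked)
  ultimately have "isotopic (kinked n x [] e (y @ [a]) y') (kinked n x [] e y (a # y'))"
    using diagram_move_isotopic[of "cups n @ crossings x @ [Cup n True, Cross (n - 1) e] @ crossings y"
       "[Cross (i - 1) d, Cap n]" "crossings y' @ caps n" "[Cap n, Cross (i - 1) d]"]
    by (simp add: a kinked_def)
  moreover have "isotopic (kinked n x [] e y (a # y')) (kinked n x [] e [] (y @ a # y'))"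
    using snoc.prems a by (intro snoc.IH) auto
  ultimately show ?case by (auto intro: isotopic.trans)
qed

text \<open>Markov's second move, for crossings of either sign: shrink the last closing arc to a
  loop, then remove the loop.\<close>

lemma isotopic_destabilise:
  assumes n: "n \<ge> 1" and x: "x \<in> braid_words n" and y: "y \<in> braid_words n"
  shows "isotopic (closure_diagram (Suc n) (x @ [(n, e)] @ y)) (closure_diagram n (x @ y))"
proof -
  have "isotopic (kinked n [] x e y []) (kinked n x [] e [] y)"
    using isotopic_kinked_left[OF n _ x y, of "[]" "[]"] isotopic_kinked_right[OF n x y, of "[]"]
    by (auto intro: isotopic.trans)
  then show ?thesis
    using isotopic_kink[OF n x y, of e]
    by (auto simp: closure_diagram_def kinked_def intro: isotopic.trans)
qed

lemma link_of_eqI: "isotopic D E \<Longrightarrow> link_of D = link_of E"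
  by (metis Quotient3_oriented_link Quotient3_rel)

section \<open>Laurent polynomials\<close>

lemma lookup_laurent_monom_mult [simp]:
  "Poly_Mapping.lookup (laurent_monom i j * p) (a, b) = Poly_Mapping.lookup p (a - i, b - j)"
  \<comment> \<open>As an additive group, the Laurent polynomials are free abelian on the exponent
    pairs, so by additivity a single monomial suffices.\<close>
  using subset_UNIV
proof (induction p rule: frag_induction)
  case (one x)
  then show ?case
    by (cases x) (auto simp: laurent_monom_def mult_single)
qed (simp_all add: right_diff_distrib lookup_minus)

text \<open>
  The value at \<open>v = 2\<close>, \<open>z = -3/2\<close>, a point of the curve \<open>z = v\<^sup>-\<^sup>1 - v\<close>, on which the constant
  function 1 satisfies the skein relation.
\<close>

definition skein_eval :: "laurent \<Rightarrow> rat" where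
  "skein_eval p = (\<Sum>k\<in>Poly_Mapping.keys p.
    of_int (Poly_Mapping.lookup p k) * (2 powi fst k * (-3/2) powi snd k))"

text \<open>Allows polynomials with different supports to be summed over a common index set.\<close>

lemma skein_eval_superset:
  assumes "finite A" "Poly_Mapping.keys p \<subseteq> A"
  shows "skein_eval p = (\<Sum>k\<in>A. of_int (Poly_Mapping.lookup p k) * (2 powi fst k * (-3/2) powi snd k))"
  unfolding skein_eval_def using assms
  by (intro sum.mono_neutral_left) (auto simp: in_keys_iff)

lemma skein_eval_0 [simp]: "skein_eval 0 = 0"
  by (simp add: skein_eval_def)

lemma skein_eval_1 [simp]: "skein_eval 1 = 1"
proof -
  have "Poly_Mapping.keys (1 :: laurent) = {0}" "Poly_Mapping.lookup (1 :: laurent) 0 = 1"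
    by (simp_all add: lookup_one)
  then show ?thesis by (simp add: skein_eval_def)
qed

lemma skein_eval_diff: "skein_eval (p - q) = skein_eval p - skein_eval q"
proof -
  let ?A = "Poly_Mapping.keys p \<union> Poly_Mapping.keys q"
  have "Poly_Mapping.keys (p - q) \<subseteq> ?A" by (rule keys_diff)
  then show ?thesis
    using skein_eval_superset[of ?A "p - q"] skein_eval_superset[of ?A p] skein_eval_superset[of ?A q]
    by (simp add: lookup_minus algebra_simps sum_subtractf)
qed

lemma skein_eval_laurent_monom_mult:
  "skein_eval (laurent_monom i j * p) = 2 powi i * (-3/2) powi j * skein_eval p"
  using subset_UNIV
proof (induction p rule: frag_induction)
  case (one x)
  then show ?case
    by (cases x) (simp add: laurent_monom_def mult_single skein_eval_def power_int_add)
qed (simp_all add: right_diff_distrib skein_eval_diff)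

text \<open>Since 1/2 - 2 = -3/2, two values equal to 1 force the third to be 1.\<close>

lemma skein_eval_skein:
  assumes "laurent_monom (-1) 0 * p - laurent_monom 1 0 * q = laurent_monom 0 1 * r"
  shows "skein_eval p / 2 - 2 * skein_eval q = - 3 / 2 * skein_eval r"
  using arg_cong[OF assms, of skein_eval]
  by (simp add: skein_eval_diff skein_eval_laurent_monom_mult)

lemma lookup_skein:
  assumes "laurent_monom (-1) 0 * p - laurent_monom 1 0 * q = laurent_monom 0 1 * r"
  shows "Poly_Mapping.lookup p (a + 1, b) - Poly_Mapping.lookup q (a - 1, b) =
    Poly_Mapping.lookup r (a, b - 1)"
  using arg_cong[OF assms, of "\<lambda>p. Poly_Mapping.lookup p (a, b)"]
  by (simp add: lookup_minus)

text \<open>Phrased by coefficients so that it makes sense for the zero polynomial, where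
  \<open>max_v_degree\<close> is a maximum over the empty set.\<close>

definition v_degree_le :: "int \<Rightarrow> laurent \<Rightarrow> bool" where
  "v_degree_le d p \<longleftrightarrow> (\<forall>a b. d < a \<longrightarrow> Poly_Mapping.lookup p (a, b) = 0)"

lemma max_v_degree_eq_iff:
  assumes "p \<noteq> 0" "v_degree_le d p"
  shows "max_v_degree p = d \<longleftrightarrow> (\<exists>b. Poly_Mapping.lookup p (d, b) \<noteq> 0)"
proof -
  have le: "fst k \<le> d" if "k \<in> Poly_Mapping.keys p" for k
    using that assms(2) by (cases k) (force simp: v_degree_le_def in_keys_iff)
  have "max_v_degree p = d \<longleftrightarrow> d \<in> fst ` Poly_Mapping.keys p"
    unfolding max_v_degree_def using assms(1) le by (subst Max_eq_iff) auto
  then show ?thesis by (force simp: in_keys_iff)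
qed

section \<open>Existence of simple resolution trees\<close>

lemma braid_class_eqI: "braid_equiv n x y \<Longrightarrow> braid_class n x = braid_class n y"
  using braid_class_eq_iff braid_equiv_words by blast

lemma positive_braids_eq:
  "positive_braids n = (\<lambda>w. braid_class n (pos_word w)) ` {w. set w \<subseteq> {1..<n}}"
proof (intro equalityI subsetI)
  fix b assume "b \<in> positive_braids n"
  then obtain v w where b: "b = braid_class n v" "braid_equiv n v w" "positive_word w"
    by (auto simp: positive_braids_def carrier_braid_group in_braid_class)
  obtain w' where w': "w = pos_word w'" using positive_wordE[OF b(3)] .
  then have "set w' \<subseteq> {1..<n}" using braid_equiv_words[OF b(2)] by simp
  moreover have "b = braid_class n (pos_word w')"
    using b(1) braid_class_eqI[OF b(2)] w' by simp
  ultimately show "b \<in> (\<lambda>w. braid_class n (pos_word w)) ` {w. set w \<subseteq> {1..<n}}" by blast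
next
  fix b assume "b \<in> (\<lambda>w. braid_class n (pos_word w)) ` {w. set w \<subseteq> {1..<n}}"
  then obtain w where w: "pos_word w \<in> braid_words n" "b = braid_class n (pos_word w)" by auto
  then have "pos_word w \<in> b" by (simp only: in_braid_class braid_equiv.refl)
  then show "b \<in> positive_braids n"
    using w positive_word_pos_word unfolding positive_braids_def carrier_braid_group by blast
qed

lemma mult_gen_square:
  assumes "set x \<subseteq> {1..<n}" "set y \<subseteq> {1..<n}" "i \<in> {1..<n}"
  shows "braid_class n (pos_word x) \<otimes>\<^bsub>braid_group n\<^esub> braid_gen n i [^]\<^bsub>braid_group n\<^esub> (2::nat)
      \<otimes>\<^bsub>braid_group n\<^esub> braid_class n (pos_word y) = braid_class n (pos_word (x @ [i, i] @ y))"
    and "braid_class n (pos_word x) \<otimes>\<^bsub>braid_group n\<^esub> braid_gen n i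
      \<otimes>\<^bsub>braid_group n\<^esub> braid_class n (pos_word y) = braid_class n (pos_word (x @ [i] @ y))"
    and "braid_class n (pos_word x) \<otimes>\<^bsub>braid_group n\<^esub> braid_class n (pos_word y) =
      braid_class n (pos_word (x @ y))"
proof -
  interpret group "braid_group n" by (rule group_braid_group)
  have "braid_gen n i [^]\<^bsub>braid_group n\<^esub> (2::nat) = braid_class n [(i, True), (i, True)]"
    using assms by (simp add: numeral_2_eq_2 braid_gen_def one_braid_group mult_braid_class)
  then show "braid_class n (pos_word x) \<otimes>\<^bsub>braid_group n\<^esub> braid_gen n i [^]\<^bsub>braid_group n\<^esub> (2::nat)
      \<otimes>\<^bsub>braid_group n\<^esub> braid_class n (pos_word y) = braid_class n (pos_word (x @ [i, i] @ y))"
    using assms by (simp add: mult_braid_class)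
  show "braid_class n (pos_word x) \<otimes>\<^bsub>braid_group n\<^esub> braid_gen n i
      \<otimes>\<^bsub>braid_group n\<^esub> braid_class n (pos_word y) = braid_class n (pos_word (x @ [i] @ y))"
    "braid_class n (pos_word x) \<otimes>\<^bsub>braid_group n\<^esub> braid_class n (pos_word y) =
      braid_class n (pos_word (x @ y))"
    using assms by (simp_all add: mult_braid_class braid_gen_def)
qed

lemma staircase_simple:
  assumes "staircase n u"
  shows "braid_class n (pos_word u) \<in> simple_braids n"
proof -
  have u: "pos_word u \<in> braid_words n" using staircase_set[OF assms] by simp
  then have "pos_word u \<in> braid_class n (pos_word u)"
    by (simp only: in_braid_class braid_equiv.refl)
  then show ?thesis
    using strand_pos_permutes[OF u] staircase_crossing_number[OF assms] u positive_word_pos_word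
    unfolding simple_braids_def permutation_braid_def carrier_braid_group by blast
qed

text \<open>A word with crossing numbers at most 1 cannot be equivalent to one with a square:
  equivalent words have equal length, but the square would force a longer word. So only the
  staircase alternative remains.\<close>

lemma simple_braidE:
  assumes "n \<ge> 1" "b \<in> simple_braids n"
  obtains u where "staircase n u" "b = braid_class n (pos_word u)"
proof -
  obtain v w where v: "b = braid_class n v" "v \<in> braid_words n" "braid_equiv n v w" "positive_word w"
    and cross: "\<And>s t. s \<in> {1..n} \<Longrightarrow> t \<in> {1..n} \<Longrightarrow> s \<noteq> t \<Longrightarrow> crossing_number w s t \<le> 1"
    using assms(2)
    by (auto simp: simple_braids_def permutation_braid_def carrier_braid_group in_braid_class)
  obtain w' where w': "w = pos_word w'" using positive_wordE v(4) .
  have w: "w \<in> braid_words n" "b = braid_class n w"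
    using v(1) braid_equiv_words[OF v(3)] braid_class_eqI[OF v(3)] by auto
  then have "set w' \<subseteq> {1..<n}" by (simp add: w')
  from staircase_or_square[OF assms(1) this] show thesis
  proof cases
    case (1 x j y)
    then show ?thesis
      using simple_word_no_square[OF w(1) cross, of x j y] word_equiv_length[OF 1] by (simp add: w')
  next
    case (2 u)
    then show ?thesis using that w(2) braid_class_eqI[OF 2(2)] by (simp add: w')
  qed
qed

text \<open>Resolving a square yields two shorter words, so induction on the length ends in
  staircase words, whose braids are simple.\<close>

lemma ex_simple_resolution_tree:
  assumes "n \<ge> 1" "set w \<subseteq> {1..<n}"
  shows "\<exists>t. simple_resolution_tree n (braid_class n (pos_word w)) t"
  using assms(2)
proof (induction w rule: length_induct)
  case (1 w)
  from assms(1) 1(2) show ?case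
  proof (cases rule: staircase_or_square)
    case (1 x j y)
    have set: "set x \<subseteq> {1..<n}" "set y \<subseteq> {1..<n}" "j \<in> {1..<n}"
      using word_equiv_set[OF 1] by auto
    obtain l r where
      l: "simple_resolution_tree n (braid_class n (pos_word (x @ y))) l" and
      r: "simple_resolution_tree n (braid_class n (pos_word (x @ [j] @ y))) r"
      using "1.IH"[rule_format, of "x @ y"] "1.IH"[rule_format, of "x @ [j] @ y"]
        word_equiv_length[OF 1] set by auto
    have pos: "braid_class n (pos_word v) \<in> positive_braids n" if "set v \<subseteq> {1..<n}" for v
      using that by (auto simp: positive_braids_eq)
    have "well_resolved n (Node (braid_class n (pos_word (x @ [j, j] @ y))) l r)"
      unfolding well_resolved.simps
    proof (intro conjI bexI)
      show "braid_class n (pos_word (x @ [j, j] @ y)) = braid_class n (pos_word x) \<otimes>\<^bsub>braid_group n\<^esub>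
          braid_gen n j [^]\<^bsub>braid_group n\<^esub> (2::nat) \<otimes>\<^bsub>braid_group n\<^esub> braid_class n (pos_word y)"
        by (rule mult_gen_square(1)[OF set, symmetric])
    qed (use l r set pos[of x] pos[of y] pos[of "x @ [j, j] @ y"] in
        \<open>simp_all add: mult_gen_square simple_resolution_tree_def resolution_tree_def\<close>)
    then have "simple_resolution_tree n (braid_class n (pos_word w))
        (Node (braid_class n (pos_word (x @ [j, j] @ y))) l r)"
      unfolding braid_class_eqI[OF 1] using l r
      by (simp add: simple_resolution_tree_def resolution_tree_def del: well_resolved.simps)
    then show ?thesis ..
  next
    case (2 u)
    have "simple_resolution_tree n (braid_class n (pos_word w)) (Leaf (braid_class n (pos_word u)))"
      using braid_class_eqI[OF 2(2)] staircase_simple[OF 2(1)] staircase_set[OF 2(1)]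
      by (auto simp: simple_resolution_tree_def resolution_tree_def positive_braids_eq)
    then show ?thesis ..
  qed
qed

section \<open>The Homflypt polynomial of positive braids\<close>

context
  fixes P :: "oriented_link \<Rightarrow> laurent"
  assumes homflypt: "homflypt P"
begin

abbreviation closure_poly :: "nat \<Rightarrow> braid_word \<Rightarrow> laurent" where
  "closure_poly n w \<equiv> P (link_of (closure_diagram n w))"

lemma closure_poly_equiv: "braid_equiv n x y \<Longrightarrow> closure_poly n x = closure_poly n y"
  using link_of_eqI[OF isotopic_closure_diagram] by metis

text \<open>All braid strands run upwards, so every letter falls under the parallel case of
  \<open>skein_triple\<close>.\<close>

lemma closure_poly_skein:
  assumes "x \<in> braid_words n" "y \<in> braid_words n" "i \<in> {1..<n}"
  shows "laurent_monom (-1) 0 * closure_poly n (x @ [(i, True)] @ y) -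
      laurent_monom 1 0 * closure_poly n (x @ [(i, False)] @ y) =
    laurent_monom 0 1 * closure_poly n (x @ y)"
proof -
  let ?D = "cups n @ crossings x" and ?E = "crossings y @ caps n"
  have "events_run ?D [] = Some (replicate n True @ replicate n False)"
    using assms(1) by (simp add: events_run_append events_run_cups events_run_braid_word del: One_nat_def)
  moreover have "Suc (i - 1) < length (replicate n True @ replicate n False)"
    "(replicate n True @ replicate n False) ! (i - 1) = (replicate n True @ replicate n False) ! Suc (i - 1)"
    using assms(3) by (auto simp: nth_append)
  moreover have "link_diagram (?D @ [Cross (i - 1) True] @ ?E)"
    using link_diagram_closure[of "x @ [(i, True)] @ y" n] assms by (simp add: closure_diagram_def)
  ultimately have "skein_triple (?D @ [Cross (i - 1) True] @ ?E) (?D @ [Cross (i - 1) False] @ ?E) (?D @ ?E)"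
    by (rule skein_triple.parallel)
  then show ?thesis
    using homflypt by (simp add: homflypt_def closure_diagram_def)
qed

text \<open>The skein relation at the second letter of the square; switching that crossing lets it
  cancel with the first one.\<close>

lemma closure_poly_square:
  assumes "set x \<subseteq> {1..<n}" "set y \<subseteq> {1..<n}" "i \<in> {1..<n}"
  shows "laurent_monom (-1) 0 * closure_poly n (pos_word (x @ [i, i] @ y)) -
      laurent_monom 1 0 * closure_poly n (pos_word (x @ y)) =
    laurent_monom 0 1 * closure_poly n (pos_word (x @ [i] @ y))"
proof -
  have "braid_relation n [(i, True), (i, False)] []"
    using braid_relation.cancel[of i n True] assms(3) by simp
  then have "closure_poly n (pos_word x @ [(i, True), (i, False)] @ pos_word y) =
      closure_poly n (pos_word x @ [] @ pos_word y)"
    using assms by (intro closure_poly_equiv braid_equiv.step) simp_all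
  then show ?thesis
    using closure_poly_skein[of "pos_word (x @ [i])" n "pos_word y" i] assms by simp
qed

lemma closure_poly_destabilise:
  assumes "n \<ge> 1" "x \<in> braid_words n" "y \<in> braid_words n"
  shows "closure_poly (Suc n) (x @ [(n, e)] @ y) = closure_poly n (x @ y)"
  using link_of_eqI[OF isotopic_destabilise[OF assms]] by metis

text \<open>A split unknot is the smoothing of the two crossings by which the strand can be stabilised.\<close>

lemma closure_poly_split:
  assumes "n \<ge> 1" "x \<in> braid_words n"
  shows "laurent_monom (-1) 0 * closure_poly n x - laurent_monom 1 0 * closure_poly n x =
    laurent_monom 0 1 * closure_poly (Suc n) x"
  using closure_poly_skein[of x "Suc n" "[]" n] closure_poly_destabilise[OF assms, of "[]"]
    braid_words_mono[OF assms(2), of "Suc n"] assms(1) by simp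

lemma closure_poly_unknot: "closure_poly (Suc 0) [] = 1"
  using homflypt by (simp add: homflypt_def closure_diagram_def unknot_def)

section \<open>The Morton-Franks-Williams bound for positive braids\<close>

lemma v_degree_le_split:
  assumes "n \<ge> 1" "x \<in> braid_words n" "v_degree_le d (closure_poly n x)"
  shows "v_degree_le (d + 1) (closure_poly (Suc n) x)"
  unfolding v_degree_le_def
proof (intro allI impI)
  fix a b assume "d + 1 < a"
  then show "Poly_Mapping.lookup (closure_poly (Suc n) x) (a, b) = 0"
    \<comment> \<open>At \<open>(a, b + 1)\<close> the left side involves the v-degrees
      \<open>a + 1\<close> and \<open>a - 1\<close>, both above \<open>d\<close>.\<close>
    using lookup_skein[OF closure_poly_split[OF assms(1,2)], of a "b + 1"] assms(3)
    by (simp add: v_degree_le_def)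
qed

text \<open>Induction on \<open>n\<close> and, inside, on the length. The coefficients
  \<open>v\<^sup>2\<close> and \<open>vz\<close> of the quadratic relation make up exactly for the
  two and one letters lost in its terms. A staircase word either loses a split strand or
  destabilises.\<close>

lemma closure_poly_bound:
  assumes "n \<ge> 1" "set w \<subseteq> {1..<n}"
  shows "skein_eval (closure_poly n (pos_word w)) = 1 \<and>
    v_degree_le (int (length w) + int n - 1) (closure_poly n (pos_word w))"
  using assms
proof (induction n arbitrary: w rule: dec_induct)
  case base
  then show ?case by (simp add: closure_poly_unknot v_degree_le_def lookup_one zero_prod_def when_def)
next
  case (step n)
  let ?good = "\<lambda>d n w. skein_eval (closure_poly n (pos_word w)) = 1 \<and>
    v_degree_le d (closure_poly n (pos_word w))"
  from step.prems show ?case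
  proof (induction w rule: length_induct)
    case (1 w)
    have "Suc n \<ge> 1" by simp
    from this 1(2) show ?case
    proof (cases rule: staircase_or_square)
      case (1 x j y)
      have set: "set x \<subseteq> {1..<Suc n}" "set y \<subseteq> {1..<Suc n}" "j \<in> {1..<Suc n}"
        using word_equiv_set[OF 1] by auto
      have len: "length w = Suc (Suc (length (x @ y)))"
        using word_equiv_length[OF 1] by simp
      have "?good (int (length (x @ y)) + int (Suc n) - 1) (Suc n) (x @ y)"
        "?good (int (length (x @ [j] @ y)) + int (Suc n) - 1) (Suc n) (x @ [j] @ y)"
        using "1.IH"[rule_format, of "x @ y"] "1.IH"[rule_format, of "x @ [j] @ y"] len set by simp_all
      then have good: "?good (int (length w) - 2 + int n) (Suc n) (x @ y)"
        "?good (int (length w) - 1 + int n) (Suc n) (x @ [j] @ y)"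
        using len by (simp_all add: algebra_simps)
      note skein = closure_poly_square[OF set]
      have "skein_eval (closure_poly (Suc n) (pos_word (x @ [j, j] @ y))) = 1"
        using skein_eval_skein[OF skein] good by simp
      moreover have "v_degree_le (int (length w) + int n) (closure_poly (Suc n) (pos_word (x @ [j, j] @ y)))"
        unfolding v_degree_le_def
      proof (intro allI impI)
        fix a b assume "int (length w) + int n < a"
        then show "Poly_Mapping.lookup (closure_poly (Suc n) (pos_word (x @ [j, j] @ y))) (a, b) = 0"
          using lookup_skein[OF skein, of "a - 1" b] good by (simp add: v_degree_le_def)
      qed
      ultimately show ?thesis
        unfolding closure_poly_equiv[OF 1] by simp
    next
      case (2 u)
      have len: "length w = length u" using word_equiv_length[OF 2(2)] .
      from 2(1) have "?good (int (length u) + int n) (Suc n) u"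
      proof cases
        case one
        then show ?thesis using step.hyps by simp
      next
        case (Suc x k)
        have x: "set x \<subseteq> {1..<n}" using staircase_set Suc by blast
        show ?thesis
        proof (cases "k = Suc n")
          case True
          then have u: "u = x" using Suc by simp
          have w: "pos_word x \<in> braid_words n" using x by simp
          have "?good (int (length x) + int n - 1) n x" using step.IH[OF x] .
          then show ?thesis
            using v_degree_le_split[OF step.hyps(1) w, of "int (length x) + int n - 1"]
              skein_eval_skein[OF closure_poly_split[OF step.hyps(1) w]]
            by (simp add: u)
        next
          case False
          \<comment> \<open>A nonempty final run contains \<open>n\<close> exactly once, at its
            start, so destabilisation applies.\<close>
          then have u: "u = x @ [n] @ rev [k..<n]" using Suc by simp
          have "set (rev [k..<n]) \<subseteq> {1..<n}" using Suc by auto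
          then show ?thesis
            using step.IH[of "x @ rev [k..<n]"] x
              closure_poly_destabilise[OF step.hyps(1), of "pos_word x" "pos_word (rev [k..<n])" True]
            by (auto simp: u v_degree_le_def)
        qed
      qed
      then show ?thesis
        unfolding closure_poly_equiv[OF 2(2)] len by simp
    qed
  qed
qed

section \<open>Coefficients in the top degree\<close>

lemma staircase_strict_bound:
  "staircase n u \<Longrightarrow> u \<noteq> [] \<Longrightarrow>
    v_degree_le (int (length u) + int n - 2) (closure_poly n (pos_word u))"
proof (induction rule: staircase.induct)
  case (Suc n u k)
  have u: "set u \<subseteq> {1..<n}" and n: "n \<ge> 1"
    using staircase_set[OF Suc.hyps(1)] Suc.hyps(1) by (auto elim: staircase.cases)
  show ?case
  proof (cases "k = Suc n")
    case True
    then show ?thesis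
      using Suc.IH Suc.prems v_degree_le_split[OF n, of "pos_word u" "int (length u) + int n - 2"] u
      by simp
  next
    case False
    then have eq: "rev [k..<Suc n] = [n] @ rev [k..<n]" using Suc by simp
    \<comment> \<open>Destabilisation lowers both length and strand number by one, hence the bound
      by two, which is more than needed.\<close>
    have "set (rev [k..<n]) \<subseteq> {1..<n}" using Suc by auto
    then show ?thesis
      using closure_poly_bound[OF n, of "u @ rev [k..<n]"] u
        closure_poly_destabilise[OF n, of "pos_word u" "pos_word (rev [k..<n])" True]
      by (auto simp: eq v_degree_le_def simp del: upt_Suc)
  qed
qed simp

text \<open>The polynomial of the unlink with \<open>n\<close> components is
  \<open>((v\<^sup>-\<^sup>1 - v) / z)\<^sup>n\<^sup>-\<^sup>1\<close>, with leading term
  \<open>(- v / z)\<^sup>n\<^sup>-\<^sup>1\<close>.\<close>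

lemma lookup_unlink:
  assumes "n \<ge> 1"
  shows "Poly_Mapping.lookup (closure_poly n []) (int n - 1, c) = (if c = 1 - int n then (-1) ^ (n - 1) else 0)"
  using assms
proof (induction n arbitrary: c rule: dec_induct)
  case base
  then show ?case by (simp add: closure_poly_unknot lookup_one zero_prod_def when_def)
next
  case (step n)
  have "Poly_Mapping.lookup (closure_poly n []) (int n + 1, c + 1) = 0"
    using closure_poly_bound[OF step.hyps(1), of "[]"] by (simp add: v_degree_le_def)
  then have "Poly_Mapping.lookup (closure_poly (Suc n) []) (int n, c) =
      - Poly_Mapping.lookup (closure_poly n []) (int n - 1, c + 1)"
    using lookup_skein[OF closure_poly_split[OF step.hyps(1)], of "[]" "int n" "c + 1"] by simp
  moreover have "(- 1 :: int) ^ n = - ((- 1) ^ (n - 1))"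
    using step.hyps by (cases n) auto
  ultimately show ?case using step.IH[of "c + 1"] by auto
qed

text \<open>
  The top coefficients of all leaves carry the same sign \<open>(-1)\<^sup>n\<^sup>-\<^sup>1\<close>, so they cannot cancel.
\<close>

lemma top_coefficients:
  assumes n: "n \<ge> 1" and "well_resolved n t" "leaf_labels t \<subseteq> simple_braids n"
    "label t = braid_class n (pos_word w)" "set w \<subseteq> {1..<n}"
  shows "(\<forall>c. 0 \<le> (-1) ^ (n - 1) *
        Poly_Mapping.lookup (closure_poly n (pos_word w)) (int (length w) + int n - 1, c)) \<and>
    ((\<exists>c. Poly_Mapping.lookup (closure_poly n (pos_word w)) (int (length w) + int n - 1, c) \<noteq> 0) \<longleftrightarrow>
      \<one>\<^bsub>braid_group n\<^esub> \<in> leaf_labels t)"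
  using assms(2-)
proof (induction t arbitrary: w)
  case (Leaf b)
  then obtain u where u: "staircase n u" "b = braid_class n (pos_word u)"
    using simple_braidE[OF n, of b] by auto
  then have eq: "word_equiv n w u"
    using Leaf.prems staircase_set[OF u(1)] by (simp flip: braid_class_eq_iff)
  \<comment> \<open>Word length is an invariant of positive braids, so only the empty word
    represents the identity.\<close>
  have one: "\<one>\<^bsub>braid_group n\<^esub> = b \<longleftrightarrow> u = []"
    using word_equiv_length[of n u "[]"] u staircase_set[OF u(1)] braid_class_eq_iff[of "pos_word u" n "[]"]
    by (auto simp: one_braid_group)
  show ?case
  proof (cases "u = []")
    case True
    then have "w = []" using word_equiv_length[OF eq] by simp
    then show ?thesis
      using True one by (auto simp: lookup_unlink[OF n])
  next
    case False
    have "Poly_Mapping.lookup (closure_poly n (pos_word w)) (int (length w) + int n - 1, c) = 0" for c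
      using staircase_strict_bound[OF u(1) False] word_equiv_length[OF eq]
      by (simp add: closure_poly_equiv[OF eq] v_degree_le_def)
    then show ?thesis using False one by simp
  qed
next
  case (Node b l r)
  obtain x y i where xy: "set x \<subseteq> {1..<n}" "set y \<subseteq> {1..<n}" "i \<in> {1..<n}"
    and b: "b = braid_class n (pos_word (x @ [i, i] @ y))"
    and l: "label l = braid_class n (pos_word (x @ y))"
    and r: "label r = braid_class n (pos_word (x @ [i] @ y))"
    using Node.prems(1) by (auto simp: positive_braids_eq mult_gen_square simp del: map_append)
  have eq: "word_equiv n w (x @ [i, i] @ y)"
    using Node.prems(3,4) b xy by (simp flip: braid_class_eq_iff)
  let ?d = "int (length w) + int n - 1"
  let ?f = "\<lambda>c. Poly_Mapping.lookup (closure_poly n (pos_word (x @ y))) (?d - 2, c)"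
    and ?g = "\<lambda>c. Poly_Mapping.lookup (closure_poly n (pos_word (x @ [i] @ y))) (?d - 1, c)"
  have len: "length w = Suc (Suc (length (x @ y)))"
    using word_equiv_length[OF eq] by simp
  have sub: "well_resolved n l" "leaf_labels l \<subseteq> simple_braids n"
    "well_resolved n r" "leaf_labels r \<subseteq> simple_braids n"
    using Node.prems by auto
  have d: "int (length (x @ y)) + int n - 1 = ?d - 2" "int (length (x @ [i] @ y)) + int n - 1 = ?d - 1"
    using len by simp_all
  have f: "\<forall>c. 0 \<le> (-1) ^ (n - 1) * ?f c" "(\<exists>c. ?f c \<noteq> 0) \<longleftrightarrow> \<one>\<^bsub>braid_group n\<^esub> \<in> leaf_labels l"
    using Node.IH(1)[OF sub(1,2) l] xy unfolding d by simp_all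
  have g: "\<forall>c. 0 \<le> (-1) ^ (n - 1) * ?g c" "(\<exists>c. ?g c \<noteq> 0) \<longleftrightarrow> \<one>\<^bsub>braid_group n\<^esub> \<in> leaf_labels r"
    using Node.IH(2)[OF sub(3,4) r] xy unfolding d by simp_all
  \<comment> \<open>The left child enters with \<open>v\<^sup>2\<close>, the right child with
    \<open>vz\<close>, which shifts the z-exponent by one.\<close>
  have fg: "Poly_Mapping.lookup (closure_poly n (pos_word w)) (?d, c) = ?f c + ?g (c - 1)" for c
    using lookup_skein[OF closure_poly_square[OF xy], of "?d - 1" c]
    unfolding closure_poly_equiv[OF eq] by (simp add: algebra_simps)
  \<comment> \<open>After multiplication by the common sign both summands are nonnegative.\<close>
  have "?f c + ?g (c - 1) = 0 \<longleftrightarrow> ?f c = 0 \<and> ?g (c - 1) = 0" for c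
  proof -
    have "?f c + ?g (c - 1) = 0 \<longleftrightarrow> (-1) ^ (n - 1) * ?f c + (-1) ^ (n - 1) * ?g (c - 1) = 0"
      by (simp flip: distrib_left)
    also have "\<dots> \<longleftrightarrow> ?f c = 0 \<and> ?g (c - 1) = 0"
      using f(1) g(1) by (subst add_nonneg_eq_0_iff) auto
    finally show ?thesis .
  qed
  moreover have "(\<exists>c. ?g (c - 1) \<noteq> 0) \<longleftrightarrow> (\<exists>c. ?g c \<noteq> 0)"
    by (metis add_diff_cancel_right')
  ultimately have "(\<exists>c. ?f c + ?g (c - 1) \<noteq> 0) \<longleftrightarrow> \<one>\<^bsub>braid_group n\<^esub> \<in> leaf_labels (Node b l r)"
    using f(2) g(2) by auto
  moreover have "0 \<le> (-1) ^ (n - 1) * (?f c + ?g (c - 1))" for c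
    using f(1) g(1) by (simp add: distrib_left)
  ultimately show ?case unfolding fg by blast
qed

end

theorem theorem3:
  fixes n :: nat and b :: braid and L :: oriented_link
  assumes "n \<ge> 1"
    and "b \<in> positive_braids n"
    and "L = braid_closure n b"
  shows "(\<exists>t. simple_resolution_tree n b t) \<and>
    (\<forall>P t. homflypt P \<longrightarrow> simple_resolution_tree n b t \<longrightarrow>
      (max_v_degree (P L) = writhe b + int n - 1 \<longleftrightarrow>
        \<one>\<^bsub>braid_group n\<^esub> \<in> leaf_labels t))"
proof -
  obtain w where w: "set w \<subseteq> {1..<n}" "b = braid_class n (pos_word w)"
    using assms(2) by (auto simp: positive_braids_eq)
  then have L: "L = link_of (closure_diagram n (pos_word w))"
    using assms(3) by (simp add: braid_closure_class)
  have writhe: "writhe b = int (length w)"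
    using w by (simp add: writhe_braid_class exponent_sum_pos_word)
  show ?thesis
  proof (intro conjI allI impI)
    show "\<exists>t. simple_resolution_tree n b t"
      using ex_simple_resolution_tree[OF assms(1) w(1)] w(2) by simp
  next
    fix P t assume P: "homflypt P" and t: "simple_resolution_tree n b t"
    have t': "well_resolved n t" "leaf_labels t \<subseteq> simple_braids n" "label t = braid_class n (pos_word w)"
      using t w(2) by (auto simp: simple_resolution_tree_def resolution_tree_def)
    have "skein_eval (P L) = 1" and deg: "v_degree_le (writhe b + int n - 1) (P L)"
      using closure_poly_bound[OF P assms(1) w(1)] by (simp_all add: L writhe)
    then have "P L \<noteq> 0" by auto
    then show "max_v_degree (P L) = writhe b + int n - 1 \<longleftrightarrow> \<one>\<^bsub>braid_group n\<^esub> \<in> leaf_labels t"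
      using top_coefficients[OF P assms(1) t' w(1)] max_v_degree_eq_iff[OF _ deg]
      by (simp add: L writhe)
  qed
qed

end
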